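(* Let $I\subset\mathbb{R}$ be an open interval, let $\alpha_1,\alpha_3,\alpha_4:I\to\mathbb{R}$ be smooth functions with $-(\alpha_1')^2+(\alpha_3')^2+(\alpha_4')^2=1$, and let $M$ be the spacelike rotational (boost invariant) surface in Minkowski space $\mathbb{E}_1^4$ given by $$\varphi(t,s)=\left(\alpha_1(s)\cosh t,\ \alpha_1(s)\sinh t,\ \alpha_3(s),\ \alpha_4(s)\right),\qquad t\in\mathbb{R},\ s\in I.$$ Suppose that $M$ is flat. Then $M$ has pointwise 1-type Gauss map if and only if its profile curve $s\mapsto(\alpha_1(s),0,\alpha_3(s),\alpha_4(s))$ is parametrized by $$\alpha_1(s)=a_1,\qquad \alpha_3(s)=\frac{1}{a_2}\cos(a_2s+a_3),\qquad \alpha_4(s)=-\frac{1}{a_2}\sin(a_2s+a_3)$$ for some real constants $a_1,a_2,a_3$ with $a_2\neq 0$, or by $$\alpha_1(s)=b_1s+b_2,$$ $$\alpha_3(s)=\int(1+b_1^2)^{1/2}\cos\left(b\ln|b_1s+b_2|\right)ds,\qquad \alpha_4(s)=\int(1+b_1^2)^{1/2}\sin\left(b\ln|b_1s+b_2|\right)ds$$ for some real constants $b_1\neq 0$, $b_2$, $b_3$, where $b=\dfrac{b_3}{b_1(1+b_1^2)^{1/2}}$.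
   Context: $\mathbb{E}_1^4$ is $\mathbb{R}^4$ with the metric $-dx_1^2+dx_2^2+dx_3^2+dx_4^2$. The surface $M$ is a spacelike immersed surface (so $\alpha_1$ is nowhere zero), and its profile curve is a unit speed spacelike curve. The surface is flat if its Gaussian curvature vanishes identically. Gauss map: $\wedge^2\mathbb{E}_1^4$ is endowed with the indefinite inner product $\langle x_1\wedge x_2,y_1\wedge y_2\rangle=\det(\langle x_i,y_j\rangle)$ and is identified with a 6-dimensional pseudo-Euclidean space. The Gauss map of $M$ is $G:M\to\wedge^2\mathbb{E}_1^4$, $G(p)=(e_1\wedge e_2)(p)$, where $e_1,e_2$ is an oriented orthonormal tangent frame of $M$; here $e_1=(\alpha_1'\cosh t,\alpha_1'\sinh t,\alpha_3',\alpha_4')$ and $e_2=(\sinh t,\cosh t,0,0)$. Laplacian: for a function on $M$ (and componentwise for vector-valued maps), $\Delta f=-\sum_{i=1}^{2}\left(e_ie_if-(\nabla_{e_i}e_i)f\right)$, where $\nabla$ is the Levi-Civita connection of $M$. $M$ has pointwise 1-type Gauss map if $\Delta G=f(G+C)$ for some smooth function $f$ on $M$ and some constant vector $C\in\wedge^2\mathbb{E}_1^4$. An indefinite integral $\int h(s)\,ds$ denotes an antiderivative of $h$.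
   Formalization: The "only if" part fails as stated; here the two families are taken up to rotations and translations of the x3x4-plane, and a third family is added, likewise up to such motions: the straight line α1 = a1, α3 = s, α4 = 0, whose Gauss map satisfies ΔG = −G/a1². *)

theory Defs
  imports "HOL-Analysis.Analysis"
begin

section \<open>Smooth maps\<close>

definition dir_deriv ::
  "'a::real_normed_vector \<Rightarrow> ('a \<Rightarrow> 'b::real_normed_vector) \<Rightarrow> 'a \<Rightarrow> 'b" where
  "dir_deriv v f = (\<lambda>x. frechet_derivative f (at x) v)"

text \<open>Intended for open \<open>S\<close> in a finite-dimensional space: all iterated directional derivatives
  exist and are again Frechet differentiable, i.e. \<open>f\<close> is of class C-infinity on \<open>S\<close>.\<close>

definition smooth_on ::
  "'a::real_normed_vector set \<Rightarrow> ('a \<Rightarrow> 'b::real_normed_vector) \<Rightarrow> bool" where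
  "smooth_on S f \<longleftrightarrow> (\<forall>vs. \<forall>x\<in>S. foldr dir_deriv vs f differentiable (at x))"


section \<open>Minkowski space and its bivectors\<close>

definition mink :: "real^4 \<Rightarrow> real^4 \<Rightarrow> real" where
  "mink x y = - (x$1 * y$1) + x$2 * y$2 + x$3 * y$3 + x$4 * y$4"

text \<open>The second exterior power of \<open>real^4\<close> is realised as the 6-dimensional space of
  skew-symmetric matrices; the entries of \<open>wedge x y\<close> above the diagonal are the Pluecker
  coordinates of the bivector.\<close>

definition wedge :: "real^4 \<Rightarrow> real^4 \<Rightarrow> real^4^4" where
  "wedge x y = (\<chi> i j. x$i * y$j - x$j * y$i)"

definition bivectors :: "(real^4^4) set" where
  "bivectors = {A. transpose A = - A}"


section \<open>Parametrized surfaces\<close>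

text \<open>A surface is given by a map \<open>\<phi>\<close> on an open set \<open>D\<close> of parameters \<open>p\<close> in \<open>real^2\<close>.
  Functions on the surface are functions of \<open>p\<close>, and tangent vector fields are represented by
  their components with respect to the coordinate fields, i.e. as maps
  \<open>real^2 \<Rightarrow> real^2\<close>; the corresponding vector in the ambient space is
  \<open>push_forward \<phi> X p\<close>.\<close>

definition push_forward ::
  "(real^2 \<Rightarrow> real^4) \<Rightarrow> (real^2 \<Rightarrow> real^2) \<Rightarrow> real^2 \<Rightarrow> real^4" where
  "push_forward \<phi> X p = frechet_derivative \<phi> (at p) (X p)"

definition spacelike_immersion :: "(real^2) set \<Rightarrow> (real^2 \<Rightarrow> real^4) \<Rightarrow> bool" where
  "spacelike_immersion D \<phi> \<longleftrightarrow> smooth_on D \<phi> \<and>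
     (\<forall>p\<in>D. \<forall>v. v \<noteq> 0 \<longrightarrow>
        mink (frechet_derivative \<phi> (at p) v) (frechet_derivative \<phi> (at p) v) > 0)"

definition coord_field :: "2 \<Rightarrow> real^2 \<Rightarrow> real^2" where
  "coord_field i = (\<lambda>p. axis i 1)"

definition induced_metric :: "(real^2 \<Rightarrow> real^4) \<Rightarrow> real^2 \<Rightarrow> real^2^2" where
  "induced_metric \<phi> p =
     (\<chi> i j. mink (push_forward \<phi> (coord_field i) p) (push_forward \<phi> (coord_field j) p))"

text \<open>The Levi-Civita connection of a metric \<open>g\<close>, via its Christoffel symbols.\<close>

definition christoffel :: "(real^2 \<Rightarrow> real^2^2) \<Rightarrow> 2 \<Rightarrow> 2 \<Rightarrow> 2 \<Rightarrow> real^2 \<Rightarrow> real" where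
  "christoffel g k i j p =
     (\<Sum>l\<in>UNIV. matrix_inv (g p) $ k $ l *
        (dir_deriv (axis i 1) (\<lambda>q. g q $ j $ l) p
         + dir_deriv (axis j 1) (\<lambda>q. g q $ i $ l) p
         - dir_deriv (axis l 1) (\<lambda>q. g q $ i $ j) p)) / 2"

definition act :: "(real^2 \<Rightarrow> real^2) \<Rightarrow> (real^2 \<Rightarrow> 'b::real_normed_vector) \<Rightarrow> real^2 \<Rightarrow> 'b" where
  "act X f p = frechet_derivative f (at p) (X p)"

definition nabla ::
  "(real^2 \<Rightarrow> real^2^2) \<Rightarrow> (real^2 \<Rightarrow> real^2) \<Rightarrow> (real^2 \<Rightarrow> real^2) \<Rightarrow> real^2 \<Rightarrow> real^2" where
  "nabla g X Y p =
     act X Y p + (\<chi> k. \<Sum>i\<in>UNIV. \<Sum>j\<in>UNIV. christoffel g k i j p * X p $ i * Y p $ j)"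

text \<open>Since coordinate fields commute, the curvature tensor on them is
  \<open>R(\<partial>\<^sub>1,\<partial>\<^sub>2)\<partial>\<^sub>2 = \<nabla>\<^sub>1\<nabla>\<^sub>2\<partial>\<^sub>2 - \<nabla>\<^sub>2\<nabla>\<^sub>1\<partial>\<^sub>2\<close>, and the Gaussian curvature is
  \<open>g(R(\<partial>\<^sub>1,\<partial>\<^sub>2)\<partial>\<^sub>2, \<partial>\<^sub>1) / det g\<close>.\<close>

definition gauss_curvature :: "(real^2 \<Rightarrow> real^2^2) \<Rightarrow> real^2 \<Rightarrow> real" where
  "gauss_curvature g p =
     (let d1 = coord_field 1; d2 = coord_field 2;
          R = nabla g d1 (nabla g d2 d2) p - nabla g d2 (nabla g d1 d2) p
      in (R \<bullet> (g p *v d1 p)) / det (g p))"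

definition flat_surface :: "(real^2) set \<Rightarrow> (real^2 \<Rightarrow> real^4) \<Rightarrow> bool" where
  "flat_surface D \<phi> \<longleftrightarrow> (\<forall>p\<in>D. gauss_curvature (induced_metric \<phi>) p = 0)"

text \<open>Here \<open>e 1, e 2\<close> is a tangent frame, orthonormal with respect to \<open>g\<close>. For vector-valued
  \<open>f\<close> the operator acts componentwise, because the Frechet derivative does.\<close>

definition laplacian ::
  "(real^2 \<Rightarrow> real^2^2) \<Rightarrow> (2 \<Rightarrow> real^2 \<Rightarrow> real^2) \<Rightarrow>
     (real^2 \<Rightarrow> 'b::real_normed_vector) \<Rightarrow> real^2 \<Rightarrow> 'b" where
  "laplacian g e f p = - (\<Sum>i\<in>UNIV. act (e i) (act (e i) f) p - act (nabla g (e i) (e i)) f p)"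

definition gauss_map ::
  "(real^2 \<Rightarrow> real^4) \<Rightarrow> (2 \<Rightarrow> real^2 \<Rightarrow> real^2) \<Rightarrow> real^2 \<Rightarrow> real^4^4" where
  "gauss_map \<phi> e p = wedge (push_forward \<phi> (e 1) p) (push_forward \<phi> (e 2) p)"

definition pointwise_1_type_gauss_map ::
  "(real^2) set \<Rightarrow> (real^2 \<Rightarrow> real^4) \<Rightarrow> (2 \<Rightarrow> real^2 \<Rightarrow> real^2) \<Rightarrow> bool" where
  "pointwise_1_type_gauss_map D \<phi> e \<longleftrightarrow>
     (\<exists>f C. smooth_on D f \<and> C \<in> bivectors \<and>
        (\<forall>p\<in>D. laplacian (induced_metric \<phi>) e (gauss_map \<phi> e) p
               = f p *\<^sub>R (gauss_map \<phi> e p + C)))"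


section \<open>Boost invariant surfaces\<close>

text \<open>The parameters are \<open>t = p$1\<close> and \<open>s = p$2\<close>.\<close>

definition boost_domain :: "real set \<Rightarrow> (real^2) set" where
  "boost_domain I = {p. p$2 \<in> I}"

definition boost_surface ::
  "(real \<Rightarrow> real) \<Rightarrow> (real \<Rightarrow> real) \<Rightarrow> (real \<Rightarrow> real) \<Rightarrow> real^2 \<Rightarrow> real^4" where
  "boost_surface \<alpha>1 \<alpha>3 \<alpha>4 p =
     vector [\<alpha>1 (p$2) * cosh (p$1), \<alpha>1 (p$2) * sinh (p$1), \<alpha>3 (p$2), \<alpha>4 (p$2)]"

text \<open>The frame \<open>e\<^sub>1 = \<partial>\<^sub>s\<close>, \<open>e\<^sub>2 = (1/\<alpha>1) \<partial>\<^sub>t\<close>; its vectors in the ambient space are computed in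
  \<open>push_forward_boost_frame\<close> below.\<close>

definition boost_frame :: "(real \<Rightarrow> real) \<Rightarrow> 2 \<Rightarrow> real^2 \<Rightarrow> real^2" where
  "boost_frame \<alpha>1 i p = (if i = 1 then axis 2 1 else (1 / \<alpha>1 (p$2)) *\<^sub>R axis 1 1)"

lemma vector_4_nth [simp]:
  "(vector [a, b, c, d] :: real^4) $ 1 = a"
  "(vector [a, b, c, d] :: real^4) $ 2 = b"
  "(vector [a, b, c, d] :: real^4) $ 3 = c"
  "(vector [a, b, c, d] :: real^4) $ 4 = d"
  by (simp_all add: vector_def)

lemma has_derivative_boost_surface:
  fixes \<alpha>1 \<alpha>3 \<alpha>4 :: "real \<Rightarrow> real"
  assumes "\<alpha>1 differentiable (at (p$2))" "\<alpha>3 differentiable (at (p$2))"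
    "\<alpha>4 differentiable (at (p$2))"
  shows "(boost_surface \<alpha>1 \<alpha>3 \<alpha>4 has_derivative
     (\<lambda>v. vector [deriv \<alpha>1 (p$2) * cosh (p$1) * v$2 + \<alpha>1 (p$2) * sinh (p$1) * v$1,
                  deriv \<alpha>1 (p$2) * sinh (p$1) * v$2 + \<alpha>1 (p$2) * cosh (p$1) * v$1,
                  deriv \<alpha>3 (p$2) * v$2, deriv \<alpha>4 (p$2) * v$2])) (at p)"
proof -
  have D: "((\<lambda>p. f (p$2)) has_derivative (\<lambda>v. deriv f (p$2) * v$2)) (at p)"
    if "f differentiable (at (p$2))" for f :: "real \<Rightarrow> real"
  proof -
    have "(f has_derivative (\<lambda>h. deriv f (p$2) * h)) (at (p$2))"
      using that
      by (metis DERIV_deriv_iff_real_differentiable has_field_derivative_def)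
    moreover have "((\<lambda>p. p$2) has_derivative (\<lambda>v. v$2)) (at p)"
      by (rule bounded_linear_imp_has_derivative) (rule bounded_linear_vec_nth)
    ultimately show ?thesis
      using has_derivative_compose by blast
  qed
  have H: "((\<lambda>p. cosh (p$1)) has_derivative (\<lambda>v. sinh (p$1) * v$1)) (at p)"
    "((\<lambda>p. sinh (p$1)) has_derivative (\<lambda>v. cosh (p$1) * v$1)) (at p)"
  proof -
    have l: "((\<lambda>p. p$1) has_derivative (\<lambda>v. v$1)) (at p)"
      by (rule bounded_linear_imp_has_derivative) (rule bounded_linear_vec_nth)
    have "(cosh has_derivative (\<lambda>h. sinh (p$1) * h)) (at (p$1))"
      "(sinh has_derivative (\<lambda>h. cosh (p$1) * h)) (at (p$1))"
      unfolding has_field_derivative_def [symmetric]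
      by (auto intro!: derivative_eq_intros)
    then show "((\<lambda>p. cosh (p$1)) has_derivative (\<lambda>v. sinh (p$1) * v$1)) (at p)"
      "((\<lambda>p. sinh (p$1)) has_derivative (\<lambda>v. cosh (p$1) * v$1)) (at p)"
      using has_derivative_compose [OF l] by blast+
  qed
  have "((\<lambda>q. boost_surface \<alpha>1 \<alpha>3 \<alpha>4 q $ i) has_derivative
     (\<lambda>v. (vector [deriv \<alpha>1 (p$2) * cosh (p$1) * v$2 + \<alpha>1 (p$2) * sinh (p$1) * v$1,
                  deriv \<alpha>1 (p$2) * sinh (p$1) * v$2 + \<alpha>1 (p$2) * cosh (p$1) * v$1,
                  deriv \<alpha>3 (p$2) * v$2, deriv \<alpha>4 (p$2) * v$2] :: real^4) $ i)) (at p)" for i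
  proof (cases i rule: exhaust_4 [THEN disjE])
    case 1
    show ?thesis
      unfolding 1 boost_surface_def vector_4_nth
      by (rule has_derivative_eq_rhs [OF has_derivative_mult [OF D [OF assms(1)] H(1)]])
         (simp add: fun_eq_iff algebra_simps)
  next
    case 2
    then consider "i = 2" | "i = 3" | "i = 4" by blast
    then show ?thesis
    proof cases
      case 1
      show ?thesis
        unfolding 1 boost_surface_def vector_4_nth
        by (rule has_derivative_eq_rhs [OF has_derivative_mult [OF D [OF assms(1)] H(2)]])
           (simp add: fun_eq_iff algebra_simps)
    next
      case 2
      show ?thesis
        unfolding 2 boost_surface_def vector_4_nth by (rule D [OF assms(2)])
    next
      case 3
      show ?thesis
        unfolding 3 boost_surface_def vector_4_nth by (rule D [OF assms(3)])
    qed
  qed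
  then show ?thesis
    by (subst has_derivative_componentwise_within)
       (auto simp: Basis_vec_def inner_axis)
qed

lemma push_forward_boost_frame:
  fixes \<alpha>1 \<alpha>3 \<alpha>4 :: "real \<Rightarrow> real"
  assumes "\<alpha>1 differentiable (at (p$2))" "\<alpha>3 differentiable (at (p$2))"
    "\<alpha>4 differentiable (at (p$2))" and "\<alpha>1 (p$2) \<noteq> 0"
  shows "push_forward (boost_surface \<alpha>1 \<alpha>3 \<alpha>4) (boost_frame \<alpha>1 1) p =
      vector [deriv \<alpha>1 (p$2) * cosh (p$1), deriv \<alpha>1 (p$2) * sinh (p$1),
              deriv \<alpha>3 (p$2), deriv \<alpha>4 (p$2)]"
    and "push_forward (boost_surface \<alpha>1 \<alpha>3 \<alpha>4) (boost_frame \<alpha>1 2) p =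
      vector [sinh (p$1), cosh (p$1), 0, 0]"
  unfolding push_forward_def
    frechet_derivative_at [OF has_derivative_boost_surface [OF assms(1-3)], symmetric]
  using assms(4) by (simp_all add: boost_frame_def axis_def vec_eq_iff forall_4)

section \<open>The families of profile curves\<close>

definition profile_circle ::
  "real set \<Rightarrow> (real \<Rightarrow> real) \<Rightarrow> (real \<Rightarrow> real) \<Rightarrow> (real \<Rightarrow> real) \<Rightarrow> bool" where
  "profile_circle I \<alpha>1 \<alpha>3 \<alpha>4 \<longleftrightarrow>
     (\<exists>a1 a2 a3. a2 \<noteq> 0 \<and>
        (\<forall>s\<in>I. \<alpha>1 s = a1 \<and> \<alpha>3 s = 1 / a2 * cos (a2 * s + a3)
               \<and> \<alpha>4 s = - (1 / a2) * sin (a2 * s + a3)))"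

definition profile_log ::
  "real set \<Rightarrow> (real \<Rightarrow> real) \<Rightarrow> (real \<Rightarrow> real) \<Rightarrow> (real \<Rightarrow> real) \<Rightarrow> bool" where
  "profile_log I \<alpha>1 \<alpha>3 \<alpha>4 \<longleftrightarrow>
     (\<exists>b1 b2 b3 b. b1 \<noteq> 0 \<and> b = b3 / (b1 * sqrt (1 + b1\<^sup>2)) \<and>
        (\<forall>s\<in>I. \<alpha>1 s = b1 * s + b2
           \<and> (\<alpha>3 has_real_derivative sqrt (1 + b1\<^sup>2) * cos (b * ln \<bar>b1 * s + b2\<bar>)) (at s)
           \<and> (\<alpha>4 has_real_derivative sqrt (1 + b1\<^sup>2) * sin (b * ln \<bar>b1 * s + b2\<bar>)) (at s)))"

definition profile_line ::
  "real set \<Rightarrow> (real \<Rightarrow> real) \<Rightarrow> (real \<Rightarrow> real) \<Rightarrow> (real \<Rightarrow> real) \<Rightarrow> bool" where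
  "profile_line I \<alpha>1 \<alpha>3 \<alpha>4 \<longleftrightarrow>
     (\<exists>a1. \<forall>s\<in>I. \<alpha>1 s = a1 \<and> \<alpha>3 s = s \<and> \<alpha>4 s = 0)"

text \<open>The profile curve has the form \<open>P\<close> after a rotation and a translation of the
  \<open>x\<^sub>3x\<^sub>4\<close>-plane. These are isometries of Minkowski space which commute with the boosts and
  do not change \<open>\<alpha>1\<close>.\<close>

definition up_to_motion ::
  "((real \<Rightarrow> real) \<Rightarrow> (real \<Rightarrow> real) \<Rightarrow> (real \<Rightarrow> real) \<Rightarrow> bool) \<Rightarrow>
     (real \<Rightarrow> real) \<Rightarrow> (real \<Rightarrow> real) \<Rightarrow> (real \<Rightarrow> real) \<Rightarrow> bool" where
  "up_to_motion P \<alpha>1 \<alpha>3 \<alpha>4 \<longleftrightarrow>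
     (\<exists>\<theta> c3 c4. P \<alpha>1 (\<lambda>s. cos \<theta> * \<alpha>3 s - sin \<theta> * \<alpha>4 s + c3)
                     (\<lambda>s. sin \<theta> * \<alpha>3 s + cos \<theta> * \<alpha>4 s + c4))"

end

theory Submission
  imports Defs
begin

text \<open>
  Write \<open>w = (\<alpha>3', \<alpha>4')\<close>. The metric of the surface is \<open>ds\<^sup>2 + \<alpha>1\<^sup>2 dt\<^sup>2\<close>, so its curvature is
  \<open>-\<alpha>1''/\<alpha>1\<close>, and flatness means that \<open>\<alpha>1 s = b1 s + b2\<close>. The unit speed condition then says that
  \<open>w\<close> has constant length \<open>\<surd>(1 + b1\<^sup>2)\<close>, so only the direction of \<open>w\<close> is free.

  The Gauss map splits as a constant plus a separated part: with \<open>\<epsilon>\<^sub>1, \<epsilon>\<^sub>2\<close> the first two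
  basis vectors and \<open>v t = (sinh t, cosh t, 0, 0)\<close>,
  \<open>G = b1 \<epsilon>\<^sub>1 \<and> \<epsilon>\<^sub>2 + w s \<and> v t\<close>. As \<open>v'' = v\<close>, the Laplacian acts on the factor \<open>w\<close> only:
  \<open>\<Delta>G = - L w \<and> v\<close> with \<open>L w = w'' + (b1/\<alpha>1) w' + w/\<alpha>1\<^sup>2\<close> (\<open>laplacian_gauss_map\<close>).

  Suppose \<open>\<Delta>G = f (G + C)\<close>. Where \<open>f\<close> does not vanish, the mixed components of \<open>C\<close> would have to
  depend on \<open>t\<close> like \<open>v\<close>, so they are zero; hence \<open>L w\<close> is a multiple of \<open>w\<close>. This also holds
  trivially if \<open>f = 0\<close> (\<open>pointwise_1_type_imp_parallel\<close>). Now
  \<open>(\<alpha>1 det(w, w'))' = \<alpha>1 det(w, L w)\<close>, so \<open>L w\<close> is parallel to \<open>w\<close> exactly if \<open>\<alpha>1\<close> times the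
  angular velocity of \<open>w\<close> is a constant \<open>c\<close> (\<open>parallel_imp_turning\<close>). Conversely, in that case
  \<open>L w = ((1 - c\<^sup>2)/\<alpha>1\<^sup>2) w\<close>, and \<open>f = (c\<^sup>2 - 1)/\<alpha>1\<^sup>2\<close> together with \<open>C = -b1 \<epsilon>\<^sub>1 \<and> \<epsilon>\<^sub>2\<close> solves the
  equation (\<open>turning_imp_pointwise_1_type\<close>).

  It remains to integrate \<open>\<vartheta>' = c/\<alpha>1\<close> for the angle \<open>\<vartheta>\<close> of \<open>w\<close>. For \<open>b1 \<noteq> 0\<close> the angle is
  \<open>(c/b1) ln \<bar>b1 s + b2\<bar>\<close> up to a constant, which a rotation removes; this is the logarithmic
  family. For \<open>b1 = 0\<close> the angle is affine in \<open>s\<close>, which gives circles if \<open>c \<noteq> 0\<close> and straight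
  lines if \<open>c = 0\<close>.
\<close>

section \<open>Derivatives on open sets\<close>

text \<open>Both functions satisfy \<open>has_derivative\<close> with the same linear maps, so the choice operator in
  \<open>frechet_derivative\<close> returns the same value, also at points where no derivative exists.\<close>

lemma frechet_derivative_cong_open:
  assumes "open S" "x \<in> S" "\<And>y. y \<in> S \<Longrightarrow> f y = g y"
  shows "frechet_derivative f (at x) = frechet_derivative g (at x)"
proof -
  have "(f has_derivative f') (at x) \<longleftrightarrow> (g has_derivative f') (at x)" for f'
    using assms has_derivative_transform_within_open [of f f' x UNIV S g]
      has_derivative_transform_within_open [of g f' x UNIV S f] by auto
  then show ?thesis
    by (simp add: frechet_derivative_def)
qed

lemma dir_deriv_eqI: "(f has_derivative f') (at x) \<Longrightarrow> dir_deriv v f x = f' v"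
  unfolding dir_deriv_def using frechet_derivative_at by metis

lemma act_eqI: "(f has_derivative f') (at p) \<Longrightarrow> act X f p = f' (X p)"
  unfolding act_def using frechet_derivative_at by metis

lemma act_cong_open:
  "open S \<Longrightarrow> p \<in> S \<Longrightarrow> (\<And>q. q \<in> S \<Longrightarrow> f q = g q) \<Longrightarrow> act X f p = act X g p"
  unfolding act_def by (subst frechet_derivative_cong_open) auto

lemma foldr_dir_deriv_cong_open:
  assumes "open S" "x \<in> S" "\<And>y. y \<in> S \<Longrightarrow> f y = g y"
  shows "foldr dir_deriv vs f x = foldr dir_deriv vs g x"
  using assms(2)
proof (induction vs arbitrary: x)
  case Nil
  then show ?case using assms by simp
next
  case (Cons v vs)
  have "frechet_derivative (foldr dir_deriv vs f) (at x)
      = frechet_derivative (foldr dir_deriv vs g) (at x)"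
    using assms(1) Cons.prems Cons.IH by (rule frechet_derivative_cong_open)
  then show ?case by (simp add: dir_deriv_def [of v])
qed

lemma differentiable_cong_open:
  assumes "open S" "x \<in> S" "\<And>y. y \<in> S \<Longrightarrow> f y = g y" "f differentiable (at x)"
  shows "g differentiable (at x)"
  using assms has_derivative_transform_within_open unfolding differentiable_def by metis

lemma smooth_on_cong_open:
  assumes "open S" "smooth_on S f" "\<And>y. y \<in> S \<Longrightarrow> f y = g y"
  shows "smooth_on S g"
  unfolding smooth_on_def
proof (intro allI ballI)
  fix vs x assume "x \<in> S"
  show "foldr dir_deriv vs g differentiable (at x)"
  proof (rule differentiable_cong_open [OF assms(1) \<open>x \<in> S\<close>])
    show "foldr dir_deriv vs f differentiable (at x)"
      using assms(2) \<open>x \<in> S\<close> unfolding smooth_on_def by blast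
    show "foldr dir_deriv vs f y = foldr dir_deriv vs g y" if "y \<in> S" for y
      using assms(1) that assms(3) by (rule foldr_dir_deriv_cong_open)
  qed
qed

lemma smooth_on_imp_differentiable: "smooth_on S f \<Longrightarrow> x \<in> S \<Longrightarrow> f differentiable (at x)"
  unfolding smooth_on_def by (metis foldr.simps(1) id_apply)

lemma smooth_on_imp_DERIV:
  fixes f :: "real \<Rightarrow> real"
  shows "smooth_on S f \<Longrightarrow> x \<in> S \<Longrightarrow> (f has_real_derivative deriv f x) (at x)"
  using smooth_on_imp_differentiable DERIV_deriv_iff_real_differentiable by blast

text \<open>Smoothness is defined by iterated directional derivatives, and \<open>deriv\<close> agrees on \<open>S\<close> with the
  derivative in the direction \<open>1\<close>.\<close>

lemma smooth_on_deriv: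
  fixes f :: "real \<Rightarrow> real"
  assumes "open S" "smooth_on S f"
  shows "smooth_on S (deriv f)"
proof (rule smooth_on_cong_open [OF assms(1)])
  show "smooth_on S (dir_deriv 1 f)"
    unfolding smooth_on_def
  proof (intro allI ballI)
    fix vs x assume "x \<in> S"
    then have "foldr dir_deriv (vs @ [1]) f differentiable (at x)"
      using assms(2) unfolding smooth_on_def by blast
    then show "foldr dir_deriv vs (dir_deriv 1 f) differentiable (at x)" by simp
  qed
  show "dir_deriv 1 f y = deriv f y" if "y \<in> S" for y
    using smooth_on_imp_DERIV [OF assms(2) that]
    by (simp add: has_field_derivative_def dir_deriv_eqI)
qed

lemma has_derivative_component:
  "(f has_vector_derivative f') (at (p$i)) \<Longrightarrow>
     ((\<lambda>p. f (p$i)) has_derivative (\<lambda>v. v$i *\<^sub>R f')) (at (p :: real^'n))"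
  unfolding has_vector_derivative_def
  by (rule has_derivative_compose)
     (auto intro!: bounded_linear_imp_has_derivative bounded_linear_vec_nth)

text \<open>Provides the smoothness of the factor \<open>(c\<^sup>2 - 1)/\<alpha>1\<^sup>2\<close>. A directional derivative maps a
  function of the form \<open>K / (a p\<^sub>i + b)\<^sup>n\<close> to one of the same form with exponent \<open>n + 1\<close> and another
  constant \<open>K\<close>, so all iterated derivatives stay in this class.\<close>

lemma smooth_on_inverse_power_affine:
  fixes k a b :: real and i :: "'n::finite"
  assumes "open S" "\<And>p. p \<in> S \<Longrightarrow> a * p$i + b \<noteq> 0"
  shows "smooth_on S (\<lambda>p :: real^'n. k / (a * p$i + b) ^ m)"
proof -
  have D: "((\<lambda>p :: real^'n. K / (a * p$i + b) ^ n) has_derivative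
      (\<lambda>v. v$i *\<^sub>R (- (real n * K * a) / (a * p$i + b) ^ Suc n))) (at p)"
    if "p \<in> S" for K n and p :: "real^'n"
  proof (rule has_derivative_component)
    have "((\<lambda>u. K / u ^ n) has_real_derivative - (real n * K) / u ^ Suc n) (at u)"
      if "u \<noteq> 0" for u
    proof (cases n)
      case (Suc m)
      have "((\<lambda>u. u ^ n) has_real_derivative real n * u ^ m) (at u)"
        using DERIV_pow [of n u] by (simp add: Suc)
      from DERIV_divide [OF DERIV_const this, of K]
      have "((\<lambda>u. K / u ^ n) has_real_derivative - (K * (real n * u ^ m)) / (u ^ n * u ^ n)) (at u)"
        using that by simp
      also have "- (K * (real n * u ^ m)) / (u ^ n * u ^ n) = - (real n * K) / u ^ Suc n"
        using that by (simp add: Suc field_simps)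
      finally show ?thesis .
    qed simp
    note power_deriv = this
    have "((\<lambda>s. K / (a * s + b) ^ n) has_real_derivative
        - (real n * K * a) / (a * s + b) ^ Suc n) (at s)" if "a * s + b \<noteq> 0" for s
    proof -
      have "((\<lambda>s. a * s + b) has_real_derivative a) (at s)"
        by (auto intro!: derivative_eq_intros)
      from DERIV_chain2 [OF power_deriv [OF that] this] show ?thesis by simp
    qed
    then show "((\<lambda>s. K / (a * s + b) ^ n) has_vector_derivative
        - (real n * K * a) / (a * p$i + b) ^ Suc n) (at (p$i))"
      using assms(2) [OF \<open>p \<in> S\<close>] by (simp add: has_real_derivative_iff_has_vector_derivative)
  qed
  have *: "\<exists>K n. \<forall>p\<in>S. foldr dir_deriv vs (\<lambda>p. k / (a * p$i + b) ^ m) p = K / (a * p$i + b) ^ n"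
    for vs
  proof (induction vs)
    case Nil
    show ?case by (intro exI [of _ k] exI [of _ m]) simp
  next
    case (Cons v vs)
    then obtain K n where IH:
      "\<And>p. p \<in> S \<Longrightarrow> foldr dir_deriv vs (\<lambda>p. k / (a * p$i + b) ^ m) p = K / (a * p$i + b) ^ n"
      by blast
    have "foldr dir_deriv (v # vs) (\<lambda>p. k / (a * p$i + b) ^ m) p
        = (v$i * - (real n * K * a)) / (a * p$i + b) ^ Suc n" if "p \<in> S" for p
    proof -
      have "foldr dir_deriv (v # vs) (\<lambda>p. k / (a * p$i + b) ^ m) p
          = dir_deriv v (\<lambda>p. K / (a * p$i + b) ^ n) p"
        using frechet_derivative_cong_open [OF assms(1) that IH]
        by (simp add: dir_deriv_def [of v])
      also have "\<dots> = (v$i * - (real n * K * a)) / (a * p$i + b) ^ Suc n"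
        using dir_deriv_eqI [OF D [OF that, of K n], of v] by (simp only: real_scaleR_def times_divide_eq_right)
      finally show ?thesis .
    qed
    then show ?case by blast
  qed
  show ?thesis
    unfolding smooth_on_def
  proof (intro allI ballI)
    fix vs and p :: "real^'n" assume "p \<in> S"
    obtain K n where eq: "\<And>p. p \<in> S \<Longrightarrow>
        foldr dir_deriv vs (\<lambda>p. k / (a * p$i + b) ^ m) p = K / (a * p$i + b) ^ n"
      using * by blast
    show "foldr dir_deriv vs (\<lambda>p. k / (a * p$i + b) ^ m) differentiable (at p)"
      by (rule differentiable_cong_open
          [OF assms(1) \<open>p \<in> S\<close> eq [symmetric] differentiableI [OF D [OF \<open>p \<in> S\<close>]]])
  qed
qed

lemma DERIV_zero_imp_constant:
  fixes f :: "real \<Rightarrow> real"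
  assumes "is_interval I" "\<And>s. s \<in> I \<Longrightarrow> (f has_real_derivative 0) (at s)"
  shows "\<exists>k. \<forall>s\<in>I. f s = k"
  using has_field_derivative_zero_constant [of I f] assms
  by (auto simp: is_interval_convex_1 intro: has_field_derivative_at_within)

text \<open>The turning angle of the profile curves on cones. Since \<open>ln \<bar>y\<bar> = ln (y\<^sup>2) / 2\<close>, both
  signs of the radius are covered by one chain rule.\<close>

lemma DERIV_log_affine:
  fixes a b k s :: real
  assumes "a * s + b \<noteq> 0"
  shows "((\<lambda>s. k * ln \<bar>a * s + b\<bar>) has_real_derivative k * a / (a * s + b)) (at s)"
proof -
  have "k * ln \<bar>y\<bar> = k / 2 * ln (y\<^sup>2)" for y :: real
    using ln_realpow [of "\<bar>y\<bar>" 2] by (cases "y = 0") simp_all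
  moreover have "((\<lambda>s. k / 2 * ln ((a * s + b)\<^sup>2)) has_real_derivative k * a / (a * s + b)) (at s)"
  proof -
    have "((\<lambda>s. (a * s + b)\<^sup>2) has_real_derivative 2 * (a * s + b) * a) (at s)"
      by (auto intro!: derivative_eq_intros)
    moreover have "(ln has_real_derivative 1 / (a * s + b)\<^sup>2) (at ((a * s + b)\<^sup>2))"
      using assms by (intro DERIV_ln_divide) simp
    ultimately have chain: "((\<lambda>s. k / 2 * ln ((a * s + b)\<^sup>2)) has_real_derivative
        k / 2 * (1 / (a * s + b)\<^sup>2 * (2 * (a * s + b) * a))) (at s)"
      by (intro DERIV_cmult DERIV_chain2 [of ln])
    have coeff: "k / 2 * (1 / u\<^sup>2 * (2 * u * a)) = k * a / u" if "u \<noteq> 0" for u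
      using that by (simp add: power2_eq_square)
    show ?thesis using chain coeff [OF assms] by (rule DERIV_cong)
  qed
  ultimately show ?thesis by (simp only:)
qed

section \<open>Bivector fields\<close>

lemma bounded_bilinear_wedge: "bounded_bilinear wedge"
  unfolding bilinear_conv_bounded_bilinear [symmetric] bilinear_def
  by (auto intro!: linearI simp: wedge_def vec_eq_iff algebra_simps)

lemma has_derivative_separated_wedge:
  assumes "(W has_vector_derivative W') (at (p$2))" "(V has_vector_derivative V') (at (p$1))"
  shows "((\<lambda>p :: real^2. wedge (W (p$2)) (V (p$1))) has_derivative
    (\<lambda>v. v$2 *\<^sub>R wedge W' (V (p$1)) + v$1 *\<^sub>R wedge (W (p$2)) V')) (at p)"
proof -
  interpret bounded_bilinear wedge by (rule bounded_bilinear_wedge)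
  show ?thesis
    by (rule has_derivative_eq_rhs
        [OF FDERIV [OF has_derivative_component [OF assms(1)] has_derivative_component [OF assms(2)]]])
       (simp add: fun_eq_iff scaleR_left scaleR_right add.commute)
qed

definition plane_vec :: "real \<Rightarrow> real \<Rightarrow> real^4" where
  "plane_vec a b = vector [0, 0, a, b]"

text \<open>The tangent vector \<open>e\<^sub>2\<close> of the boost orbits.\<close>

definition hyp_vec :: "real \<Rightarrow> real^4" where
  "hyp_vec t = vector [sinh t, cosh t, 0, 0]"

lemma has_vector_derivative_plane_vec:
  assumes "(a has_real_derivative a') (at s)" "(b has_real_derivative b') (at s)"
  shows "((\<lambda>s. plane_vec (a s) (b s)) has_vector_derivative plane_vec a' b') (at s)"
proof -
  have "plane_vec u v = u *\<^sub>R axis 3 1 + v *\<^sub>R axis 4 1" for u v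
    by (simp add: plane_vec_def vec_eq_iff forall_4 axis_def)
  with assms show ?thesis
    by (auto intro!: derivative_eq_intros)
qed

lemma has_vector_derivative_hyp_vec:
  "(hyp_vec has_vector_derivative vector [cosh t, sinh t, 0, 0]) (at t)"
  "((\<lambda>t. vector [cosh t, sinh t, 0, 0]) has_vector_derivative hyp_vec t) (at t)"
proof -
  have "vector [u, v, 0, 0] = u *\<^sub>R axis 1 1 + v *\<^sub>R (axis 2 1 :: real^4)" for u v :: real
    by (simp add: vec_eq_iff forall_4 axis_def)
  then show "(hyp_vec has_vector_derivative vector [cosh t, sinh t, 0, 0]) (at t)"
    "((\<lambda>t. vector [cosh t, sinh t, 0, 0]) has_vector_derivative hyp_vec t) (at t)"
    by (auto simp: hyp_vec_def [abs_def] intro!: derivative_eq_intros)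
qed

section \<open>Metric, connection and curvature of a boost invariant surface\<close>

lemma matrix_inv_diag_2:
  fixes a b :: real
  assumes "a \<noteq> 0" "b \<noteq> 0"
  shows "matrix_inv (vector [vector [a, 0], vector [0, b]] :: real^2^2)
    = vector [vector [1 / a, 0], vector [0, 1 / b]]" (is "matrix_inv ?A = ?B")
proof -
  have AB: "?A ** ?B = mat 1" "?B ** ?A = mat 1"
    using assms by (auto simp: matrix_matrix_mult_def mat_def vec_eq_iff forall_2 sum_2)
  then have "\<exists>A'. ?A ** A' = mat 1 \<and> A' ** ?A = mat 1" by blast
  then have "?A ** matrix_inv ?A = mat 1"
    unfolding matrix_inv_def by (rule someI2_ex) auto
  then have "(?B ** ?A) ** matrix_inv ?A = ?B"
    by (simp only: matrix_mul_assoc [symmetric] matrix_mul_rid)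
  then show ?thesis
    by (simp only: AB(2) matrix_mul_lid)
qed

text \<open>The coordinate vector \<open>\<partial>\<^sub>t\<close> has square \<open>\<alpha>1\<^sup>2\<close>.\<close>

lemma spacelike_immersion_radius_nonzero:
  assumes "spacelike_immersion (boost_domain I) (boost_surface \<alpha>1 \<alpha>3 \<alpha>4)" "s \<in> I"
    "\<alpha>1 differentiable (at s)" "\<alpha>3 differentiable (at s)" "\<alpha>4 differentiable (at s)"
  shows "\<alpha>1 s \<noteq> 0"
proof
  assume "\<alpha>1 s = 0"
  let ?p = "vector [0, s] :: real^2" and ?v = "axis 1 1 :: real^2"
  have "?p \<in> boost_domain I" using assms(2) by (simp add: boost_domain_def)
  moreover have "?v \<noteq> 0" by (simp add: axis_eq_0_iff)
  ultimately have "mink (frechet_derivative (boost_surface \<alpha>1 \<alpha>3 \<alpha>4) (at ?p) ?v)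
      (frechet_derivative (boost_surface \<alpha>1 \<alpha>3 \<alpha>4) (at ?p) ?v) > 0"
    using assms(1) unfolding spacelike_immersion_def by blast
  then show False
    using assms(3-5) \<open>\<alpha>1 s = 0\<close>
    by (subst (asm) (1 2) frechet_derivative_at [OF has_derivative_boost_surface, symmetric])
       (simp_all add: mink_def axis_def)
qed

locale boost_profile =
  fixes I :: "real set" and \<alpha>1 \<alpha>3 \<alpha>4 :: "real \<Rightarrow> real"
  assumes open_I: "open I" and interval_I: "is_interval I" and nonempty_I: "I \<noteq> {}"
    and smooth: "smooth_on I \<alpha>1" "smooth_on I \<alpha>3" "smooth_on I \<alpha>4"
    and unit_speed: "s \<in> I \<Longrightarrow> - (deriv \<alpha>1 s)\<^sup>2 + (deriv \<alpha>3 s)\<^sup>2 + (deriv \<alpha>4 s)\<^sup>2 = 1"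
    and radius_nonzero: "s \<in> I \<Longrightarrow> \<alpha>1 s \<noteq> 0"
begin

abbreviation "D \<equiv> boost_domain I"
abbreviation "\<phi> \<equiv> boost_surface \<alpha>1 \<alpha>3 \<alpha>4"
abbreviation "e \<equiv> boost_frame \<alpha>1"
abbreviation "g \<equiv> induced_metric \<phi>"

lemma open_D: "open D"
proof -
  have "D = (\<lambda>p. p$2) -` I" by (auto simp: boost_domain_def)
  then show ?thesis
    using open_vimage [OF open_I, of "\<lambda>p. p$2"] by (simp add: continuous_on_component)
qed

lemmas derivs =
  smooth_on_imp_DERIV [OF smooth(1)] smooth_on_imp_DERIV [OF smooth(2)]
  smooth_on_imp_DERIV [OF smooth(3)]
  smooth_on_imp_DERIV [OF smooth_on_deriv [OF open_I smooth(1)]]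
  smooth_on_imp_DERIV [OF smooth_on_deriv [OF open_I smooth(2)]]
  smooth_on_imp_DERIV [OF smooth_on_deriv [OF open_I smooth(3)]]
  smooth_on_imp_DERIV [OF smooth_on_deriv [OF open_I smooth_on_deriv [OF open_I smooth(2)]]]
  smooth_on_imp_DERIV [OF smooth_on_deriv [OF open_I smooth_on_deriv [OF open_I smooth(3)]]]

lemma metric:
  assumes "p \<in> D"
  shows "g p = vector [vector [(\<alpha>1 (p$2))\<^sup>2, 0], vector [0, 1]]"
proof -
  have s: "p$2 \<in> I" using assms by (simp add: boost_domain_def)
  note d = smooth(1-3) [THEN smooth_on_imp_differentiable, OF s]
  have 1: "push_forward \<phi> (coord_field 1) p =
      vector [\<alpha>1 (p$2) * sinh (p$1), \<alpha>1 (p$2) * cosh (p$1), 0, 0]"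
    and 2: "push_forward \<phi> (coord_field 2) p =
      vector [deriv \<alpha>1 (p$2) * cosh (p$1), deriv \<alpha>1 (p$2) * sinh (p$1),
        deriv \<alpha>3 (p$2), deriv \<alpha>4 (p$2)]"
    unfolding push_forward_def frechet_derivative_at [OF has_derivative_boost_surface [OF d], symmetric]
    by (simp_all add: coord_field_def axis_def vec_eq_iff forall_4)
  have h: "cosh (p$1) ^ 2 = 1 + sinh (p$1) ^ 2"
    by (simp add: cosh_square_eq add.commute)
  have "(\<alpha>1 (p$2) * cosh (p$1))\<^sup>2 - (\<alpha>1 (p$2) * sinh (p$1))\<^sup>2 = (\<alpha>1 (p$2))\<^sup>2"
    "(deriv \<alpha>1 (p$2) * sinh (p$1))\<^sup>2 - (deriv \<alpha>1 (p$2) * cosh (p$1))\<^sup>2 = - (deriv \<alpha>1 (p$2))\<^sup>2"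
    unfolding power_mult_distrib h by (simp_all add: algebra_simps)
  with unit_speed [OF s] show ?thesis
    unfolding induced_metric_def
    by (simp add: vec_eq_iff forall_2 1 2 mink_def power2_eq_square algebra_simps)
qed

lemma dir_deriv_metric:
  assumes "p \<in> D"
  shows "dir_deriv v (\<lambda>q. g q $ i $ j) p =
    (if i = 1 \<and> j = 1 then 2 * \<alpha>1 (p$2) * deriv \<alpha>1 (p$2) * v$2 else 0)"
proof -
  have s: "p$2 \<in> I" using assms by (simp add: boost_domain_def)
  have E: "dir_deriv v (\<lambda>q. g q $ i $ j) p
      = dir_deriv v (\<lambda>q. vector [vector [(\<alpha>1 (q$2))\<^sup>2, 0], vector [0, 1]] $ i $ j) p"
    unfolding dir_deriv_def
    by (subst frechet_derivative_cong_open [OF open_D assms]) (auto simp: metric)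
  have "((\<lambda>s. (\<alpha>1 s)\<^sup>2) has_vector_derivative 2 * \<alpha>1 (p$2) * deriv \<alpha>1 (p$2)) (at (p$2))"
    unfolding has_real_derivative_iff_has_vector_derivative [symmetric]
    using derivs(1) [OF s] by (auto intro!: derivative_eq_intros)
  from dir_deriv_eqI [OF has_derivative_component [OF this]] E dir_deriv_eqI [OF has_derivative_const]
  show ?thesis using exhaust_2 [of i] exhaust_2 [of j] by auto
qed

text \<open>The Christoffel symbols of \<open>\<alpha>1\<^sup>2 dt\<^sup>2 + ds\<^sup>2\<close> that do not vanish are
  \<open>\<alpha>1'/\<alpha>1\<close> (upper index \<open>t\<close>, mixed lower indices) and \<open>-\<alpha>1 \<alpha>1'\<close> (upper index \<open>s\<close>, lower indices
  \<open>t, t\<close>).\<close>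

lemma nabla_eq:
  assumes "p \<in> D"
  shows "nabla g X Y p = act X Y p +
    vector [deriv \<alpha>1 (p$2) / \<alpha>1 (p$2) * (X p $ 1 * Y p $ 2 + X p $ 2 * Y p $ 1),
            - (\<alpha>1 (p$2) * deriv \<alpha>1 (p$2)) * (X p $ 1 * Y p $ 1)]"
proof -
  have "p$2 \<in> I" using assms by (simp add: boost_domain_def)
  then have "\<alpha>1 (p$2) \<noteq> 0" by (rule radius_nonzero)
  then show ?thesis
    unfolding nabla_def christoffel_def
    by (simp add: vec_eq_iff forall_2 sum_2 dir_deriv_metric [OF assms] metric [OF assms]
        matrix_inv_diag_2 axis_def power2_eq_square field_simps)
qed

lemma gauss_curvature_eq:
  assumes "p \<in> D"
  shows "gauss_curvature g p = - deriv (deriv \<alpha>1) (p$2) / \<alpha>1 (p$2)"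
proof -
  have s: "p$2 \<in> I" using assms by (simp add: boost_domain_def)
  let ?d1 = "coord_field 1" and ?d2 = "coord_field 2"
  let ?h = "\<lambda>s. deriv \<alpha>1 s / \<alpha>1 s"
  have c0: "act X (coord_field i) q = 0" for X i q
    unfolding coord_field_def by (subst act_eqI [OF has_derivative_const]) simp
  have 22: "nabla g ?d2 ?d2 q = 0" and 12: "nabla g ?d1 ?d2 q = ?h (q$2) *\<^sub>R axis 1 1"
    if "q \<in> D" for q
    unfolding nabla_eq [OF that] c0
    by (simp_all add: coord_field_def axis_def vec_eq_iff forall_2)
  have "act ?d1 (nabla g ?d2 ?d2) p = act ?d1 (\<lambda>_. 0) p"
    by (rule act_cong_open [OF open_D assms]) (rule 22)
  also have "\<dots> = 0" by (subst act_eqI [OF has_derivative_const]) simp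
  finally have R1: "nabla g ?d1 (nabla g ?d2 ?d2) p = 0"
    unfolding nabla_eq [OF assms, of ?d1 "nabla g ?d2 ?d2"] 22 [OF assms] by (simp add: vec_eq_iff forall_2)
  let ?h' = "deriv (deriv \<alpha>1) (p$2) / \<alpha>1 (p$2) - (?h (p$2))\<^sup>2"
  have "(?h has_real_derivative ?h') (at (p$2))"
    by (rule derivative_eq_intros derivs(1,4) s radius_nonzero refl)+
       (use radius_nonzero [OF s] in \<open>simp add: field_simps power2_eq_square\<close>)
  then have "((\<lambda>s. ?h s *\<^sub>R (axis 1 1 :: real^2)) has_vector_derivative ?h' *\<^sub>R axis 1 1) (at (p$2))"
    using has_vector_derivative_scaleR [OF _ has_vector_derivative_const] by fastforce
  from act_eqI [OF has_derivative_component [OF this]]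
  have "act ?d2 (\<lambda>q. ?h (q$2) *\<^sub>R (axis 1 1 :: real^2)) p = ?h' *\<^sub>R axis 1 1"
    by (simp add: coord_field_def)
  moreover have "act ?d2 (nabla g ?d1 ?d2) p = act ?d2 (\<lambda>q. ?h (q$2) *\<^sub>R axis 1 1) p"
    by (rule act_cong_open [OF open_D assms]) (rule 12)
  ultimately have R2: "nabla g ?d2 (nabla g ?d1 ?d2) p
      = (deriv (deriv \<alpha>1) (p$2) / \<alpha>1 (p$2)) *\<^sub>R axis 1 1"
    unfolding nabla_eq [OF assms, of ?d2 "nabla g ?d1 ?d2"] 12 [OF assms]
    by (simp add: coord_field_def axis_def vec_eq_iff forall_2 power2_eq_square)
  show ?thesis
    unfolding gauss_curvature_def Let_def R1 R2 metric [OF assms]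
    using radius_nonzero [OF s]
    by (simp add: coord_field_def axis_def inner_vec_def sum_2 det_2 matrix_vector_mult_def
        power2_eq_square)
qed

lemma flat_imp_affine:
  assumes "flat_surface D \<phi>"
  obtains b1 b2 where "\<And>s. s \<in> I \<Longrightarrow> \<alpha>1 s = b1 * s + b2"
proof -
  have "deriv (deriv \<alpha>1) s = 0" if "s \<in> I" for s
  proof -
    have "vector [0, s] \<in> D" using that by (simp add: boost_domain_def)
    with assms gauss_curvature_eq [OF this] radius_nonzero [OF that] show ?thesis
      by (auto simp: flat_surface_def)
  qed
  then have const: "(deriv \<alpha>1 has_real_derivative 0) (at s)" if "s \<in> I" for s
    using derivs(4) [OF that] that by simp
  obtain b1 where b1: "\<And>s. s \<in> I \<Longrightarrow> deriv \<alpha>1 s = b1"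
    using DERIV_zero_imp_constant [OF interval_I const] by blast
  have const: "((\<lambda>s. \<alpha>1 s - b1 * s) has_real_derivative 0) (at s)" if "s \<in> I" for s
    using derivs(1) [OF that] b1 [OF that] by (auto intro!: derivative_eq_intros)
  obtain b2 where "\<And>s. s \<in> I \<Longrightarrow> \<alpha>1 s - b1 * s = b2"
    using DERIV_zero_imp_constant [OF interval_I const] by blast
  then have "\<And>s. s \<in> I \<Longrightarrow> \<alpha>1 s = b1 * s + b2" by (simp add: algebra_simps)
  then show ?thesis by (rule that)
qed

section \<open>Profile curves with turning rate inversely proportional to the radius\<close>

text \<open>The vector \<open>w = (\<alpha>3', \<alpha>4')\<close> rotates with angular velocity \<open>c / \<alpha>1\<close>. Stated as a linear
  system, the condition needs no choice of an angle.\<close>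

definition turning :: "real \<Rightarrow> bool" where
  "turning c \<longleftrightarrow> (\<forall>s\<in>I. deriv (deriv \<alpha>3) s = - (c / \<alpha>1 s) * deriv \<alpha>4 s
                    \<and> deriv (deriv \<alpha>4) s = c / \<alpha>1 s * deriv \<alpha>3 s)"

text \<open>Recognizes the profile families: a rotation or translation of the plane of \<open>\<alpha>3, \<alpha>4\<close> shifts
  the angle \<open>\<Theta>\<close> of the velocity by a constant and so does not affect its derivative.\<close>

lemma turning_if_angle:
  assumes \<Theta>: "\<And>s. s \<in> I \<Longrightarrow> (\<Theta> has_real_derivative c / \<alpha>1 s) (at s)"
    and \<beta>3: "\<And>s. s \<in> I \<Longrightarrow>
      ((\<lambda>s. cos \<theta> * \<alpha>3 s - sin \<theta> * \<alpha>4 s + c3) has_real_derivative r * cos (\<Theta> s)) (at s)"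
    and \<beta>4: "\<And>s. s \<in> I \<Longrightarrow>
      ((\<lambda>s. sin \<theta> * \<alpha>3 s + cos \<theta> * \<alpha>4 s + c4) has_real_derivative r * sin (\<Theta> s)) (at s)"
  shows "turning c"
proof -
  have w: "deriv \<alpha>3 s = r * cos (\<Theta> s - \<theta>)" "deriv \<alpha>4 s = r * sin (\<Theta> s - \<theta>)" if s: "s \<in> I" for s
  proof -
    have "((\<lambda>s. cos \<theta> * \<alpha>3 s - sin \<theta> * \<alpha>4 s + c3) has_real_derivative
        cos \<theta> * deriv \<alpha>3 s - sin \<theta> * deriv \<alpha>4 s) (at s)"
      "((\<lambda>s. sin \<theta> * \<alpha>3 s + cos \<theta> * \<alpha>4 s + c4) has_real_derivative
        sin \<theta> * deriv \<alpha>3 s + cos \<theta> * deriv \<alpha>4 s) (at s)"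
      using derivs(2,3) [OF s] by (auto intro!: derivative_eq_intros)
    then have "r * cos (\<Theta> s) = cos \<theta> * deriv \<alpha>3 s - sin \<theta> * deriv \<alpha>4 s"
      "r * sin (\<Theta> s) = sin \<theta> * deriv \<alpha>3 s + cos \<theta> * deriv \<alpha>4 s"
      using \<beta>3 [OF s] \<beta>4 [OF s] DERIV_unique by blast+
    moreover have "(cos \<theta>)\<^sup>2 + (sin \<theta>)\<^sup>2 = 1" by simp
    ultimately show "deriv \<alpha>3 s = r * cos (\<Theta> s - \<theta>)" "deriv \<alpha>4 s = r * sin (\<Theta> s - \<theta>)"
      unfolding cos_diff sin_diff by algebra+
  qed
  show ?thesis
    unfolding turning_def
  proof (intro ballI conjI)
    fix s assume s: "s \<in> I"
    have "((\<lambda>s. r * cos (\<Theta> s - \<theta>)) has_real_derivative - (c / \<alpha>1 s) * (r * sin (\<Theta> s - \<theta>))) (at s)"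
      "((\<lambda>s. r * sin (\<Theta> s - \<theta>)) has_real_derivative c / \<alpha>1 s * (r * cos (\<Theta> s - \<theta>))) (at s)"
      using \<Theta> [OF s] by (auto intro!: derivative_eq_intros)
    then have "(deriv \<alpha>3 has_real_derivative - (c / \<alpha>1 s) * deriv \<alpha>4 s) (at s)"
      "(deriv \<alpha>4 has_real_derivative c / \<alpha>1 s * deriv \<alpha>3 s) (at s)"
      using has_field_derivative_transform_within_open [OF _ open_I s] w s by (metis (no_types, lifting))+
    then show "deriv (deriv \<alpha>3) s = - (c / \<alpha>1 s) * deriv \<alpha>4 s"
      "deriv (deriv \<alpha>4) s = c / \<alpha>1 s * deriv \<alpha>3 s"
      by (auto intro: DERIV_imp_deriv)
  qed
qed

text \<open>The tangent of the circle of angle \<open>a\<^sub>2 s + a\<^sub>3\<close> has angle \<open>- (a\<^sub>2 s + a\<^sub>3) - \<pi>/2\<close>: the circle is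
  traversed clockwise for \<open>a\<^sub>2 > 0\<close>, because \<open>\<alpha>4\<close> carries a minus sign.\<close>

lemma turning_if_profile_circle:
  assumes "up_to_motion (profile_circle I) \<alpha>1 \<alpha>3 \<alpha>4"
  shows "\<exists>c. turning c"
proof -
  obtain \<theta> c3 c4 a1 a2 a3 where "a2 \<noteq> 0"
    and \<alpha>: "\<And>s. s \<in> I \<Longrightarrow> \<alpha>1 s = a1 \<and>
      cos \<theta> * \<alpha>3 s - sin \<theta> * \<alpha>4 s + c3 = 1 / a2 * cos (a2 * s + a3) \<and>
      sin \<theta> * \<alpha>3 s + cos \<theta> * \<alpha>4 s + c4 = - (1 / a2) * sin (a2 * s + a3)"
    using assms unfolding up_to_motion_def profile_circle_def by blast
  have angle: "cos (- (a2 * s + a3) - pi / 2) = - sin (a2 * s + a3)"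
    "sin (- (a2 * s + a3) - pi / 2) = - cos (a2 * s + a3)" for s
    unfolding cos_diff sin_diff sin_minus cos_minus by simp_all
  have "turning (- a2 * a1)"
  proof (rule turning_if_angle)
    fix s assume s: "s \<in> I"
    then have "a1 \<noteq> 0" using \<alpha> radius_nonzero by metis
    then show "((\<lambda>s. - (a2 * s + a3) - pi / 2) has_real_derivative - a2 * a1 / \<alpha>1 s) (at s)"
      using \<alpha> [OF s] by (auto intro!: derivative_eq_intros)
    have "((\<lambda>s. 1 / a2 * cos (a2 * s + a3)) has_real_derivative
        1 * cos (- (a2 * s + a3) - pi / 2)) (at s)"
      "((\<lambda>s. - (1 / a2) * sin (a2 * s + a3)) has_real_derivative
        1 * sin (- (a2 * s + a3) - pi / 2)) (at s)"
      unfolding angle using \<open>a2 \<noteq> 0\<close> by (auto intro!: derivative_eq_intros)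
    then show "((\<lambda>s. cos \<theta> * \<alpha>3 s - sin \<theta> * \<alpha>4 s + c3) has_real_derivative
        1 * cos (- (a2 * s + a3) - pi / 2)) (at s)"
      "((\<lambda>s. sin \<theta> * \<alpha>3 s + cos \<theta> * \<alpha>4 s + c4) has_real_derivative
        1 * sin (- (a2 * s + a3) - pi / 2)) (at s)"
      by (auto elim!: has_field_derivative_transform_within_open [OF _ open_I s] simp: \<alpha>)
  qed
  then show ?thesis ..
qed

lemma turning_if_profile_log:
  assumes "up_to_motion (profile_log I) \<alpha>1 \<alpha>3 \<alpha>4"
  shows "\<exists>c. turning c"
proof -
  obtain \<theta> c3 c4 a b2 b where
    \<alpha>1: "\<And>s. s \<in> I \<Longrightarrow> \<alpha>1 s = a * s + b2"
    and \<beta>: "\<And>s. s \<in> I \<Longrightarrow> ((\<lambda>s. cos \<theta> * \<alpha>3 s - sin \<theta> * \<alpha>4 s + c3) has_real_derivative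
        sqrt (1 + a\<^sup>2) * cos (b * ln \<bar>a * s + b2\<bar>)) (at s)"
      "\<And>s. s \<in> I \<Longrightarrow> ((\<lambda>s. sin \<theta> * \<alpha>3 s + cos \<theta> * \<alpha>4 s + c4) has_real_derivative
        sqrt (1 + a\<^sup>2) * sin (b * ln \<bar>a * s + b2\<bar>)) (at s)"
    using assms unfolding up_to_motion_def profile_log_def by blast
  have "turning (b * a)"
    using \<alpha>1 radius_nonzero DERIV_log_affine by (intro turning_if_angle [OF _ \<beta>]) metis+
  then show ?thesis ..
qed

lemma turning_if_profile_line:
  assumes "up_to_motion (profile_line I) \<alpha>1 \<alpha>3 \<alpha>4"
  shows "\<exists>c. turning c"
proof -
  obtain \<theta> c3 c4 where
    \<alpha>: "\<And>s. s \<in> I \<Longrightarrow> cos \<theta> * \<alpha>3 s - sin \<theta> * \<alpha>4 s + c3 = s \<and>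
      sin \<theta> * \<alpha>3 s + cos \<theta> * \<alpha>4 s + c4 = 0"
    using assms unfolding up_to_motion_def profile_line_def by blast
  have "turning 0"
  proof (rule turning_if_angle)
    fix s assume s: "s \<in> I"
    show "((\<lambda>s. 0) has_real_derivative 0 / \<alpha>1 s) (at s)" by simp
    show "((\<lambda>s. cos \<theta> * \<alpha>3 s - sin \<theta> * \<alpha>4 s + c3) has_real_derivative 1 * cos 0) (at s)"
      by (rule has_field_derivative_transform_within_open [OF _ open_I s, of "\<lambda>s. s"])
         (simp_all add: \<alpha>)
    show "((\<lambda>s. sin \<theta> * \<alpha>3 s + cos \<theta> * \<alpha>4 s + c4) has_real_derivative 1 * sin 0) (at s)"
      by (rule has_field_derivative_transform_within_open [OF _ open_I s, of "\<lambda>s. 0"])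
         (simp_all add: \<alpha>)
  qed
  then show ?thesis ..
qed

end

section \<open>The Laplacian of the Gauss map of a flat surface\<close>

locale flat_boost_profile = boost_profile +
  fixes b1 b2 :: real
  assumes radius_affine: "s \<in> I \<Longrightarrow> \<alpha>1 s = b1 * s + b2"
begin

text \<open>The component of \<open>e\<^sub>1\<close> in the Lorentz plane contributes
  \<open>\<alpha>1' (cosh t, sinh t) \<and> (sinh t, cosh t)\<close>, which is independent of \<open>t\<close> because
  \<open>cosh\<^sup>2 t - sinh\<^sup>2 t = 1\<close>.\<close>

lemma gauss_map_eq:
  assumes "p \<in> D"
  shows "gauss_map \<phi> e p = deriv \<alpha>1 (p$2) *\<^sub>R wedge (axis 1 1) (axis 2 1)
    + wedge (plane_vec (deriv \<alpha>3 (p$2)) (deriv \<alpha>4 (p$2))) (hyp_vec (p$1))"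
proof -
  have s: "p$2 \<in> I" using assms by (simp add: boost_domain_def)
  note d = smooth(1-3) [THEN smooth_on_imp_differentiable, OF s]
  have "cosh (p$1) * cosh (p$1) = 1 + sinh (p$1) * sinh (p$1)"
    using cosh_square_eq [of "p$1"] by (simp add: power2_eq_square)
  from arg_cong [OF this, of "\<lambda>y. y * x" for x]
  have h: "cosh (p$1) * (cosh (p$1) * x) = x + sinh (p$1) * (sinh (p$1) * x)" for x
    by (simp add: algebra_simps)
  show ?thesis
    unfolding gauss_map_def push_forward_boost_frame [OF d radius_nonzero [OF s]]
    by (simp add: wedge_def vec_eq_iff forall_4 plane_vec_def hyp_vec_def axis_def algebra_simps h)
qed

lemma deriv_radius: "s \<in> I \<Longrightarrow> deriv \<alpha>1 s = b1"
proof -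
  assume s: "s \<in> I"
  have "((\<lambda>s. b1 * s + b2) has_real_derivative b1) (at s)"
    by (auto intro!: derivative_eq_intros)
  then have "(\<alpha>1 has_real_derivative b1) (at s)"
    by (rule has_field_derivative_transform_within_open [OF _ open_I s]) (simp add: radius_affine)
  then show ?thesis by (rule DERIV_imp_deriv)
qed

lemma velocity_norm: "s \<in> I \<Longrightarrow> (deriv \<alpha>3 s)\<^sup>2 + (deriv \<alpha>4 s)\<^sup>2 = 1 + b1\<^sup>2"
  using unit_speed [of s] deriv_radius [of s] by simp

text \<open>The factor of the Laplacian that acts on \<open>s\<close> for a separated function \<open>f s * v t\<close> with
  \<open>v'' = v\<close>, without the sign: the first-order term comes from \<open>\<nabla>\<^sub>e\<^sub>2 e\<^sub>2 = - (b1/\<alpha>1) \<partial>\<^sub>s\<close>, the last term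
  from \<open>\<partial>\<^sub>t\<^sup>2 / \<alpha>1\<^sup>2\<close>.\<close>

definition radial_laplacian :: "(real \<Rightarrow> real) \<Rightarrow> real \<Rightarrow> real" where
  "radial_laplacian f s = deriv (deriv f) s + b1 / \<alpha>1 s * deriv f s + f s / (\<alpha>1 s)\<^sup>2"

lemma laplacian_gauss_map:
  assumes p: "p \<in> D"
  shows "laplacian g e (gauss_map \<phi> e) p =
    - wedge (plane_vec (radial_laplacian (deriv \<alpha>3) (p$2)) (radial_laplacian (deriv \<alpha>4) (p$2)))
            (hyp_vec (p$1))"
proof -
  let ?B = "b1 *\<^sub>R wedge (axis 1 1) (axis 2 1)"
  let ?w = "\<lambda>s. plane_vec (deriv \<alpha>3 s) (deriv \<alpha>4 s)"
  let ?w' = "\<lambda>s. plane_vec (deriv (deriv \<alpha>3) s) (deriv (deriv \<alpha>4) s)"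
  let ?w'' = "\<lambda>s. plane_vec (deriv (deriv (deriv \<alpha>3)) s) (deriv (deriv (deriv \<alpha>4)) s)"
  let ?u = "\<lambda>t. vector [cosh t, sinh t, 0, 0] :: real^4"
  let ?x = "\<alpha>1 (p$2)"
  interpret bounded_bilinear wedge by (rule bounded_bilinear_wedge)
  have DI: "q$2 \<in> I" if "q \<in> D" for q using that by (simp add: boost_domain_def)
  note w' = has_vector_derivative_plane_vec [OF derivs(5,6)]
  note w'' = has_vector_derivative_plane_vec [OF derivs(7,8)]
  have e: "e 1 = (\<lambda>_. axis 2 1)" "e 2 = (\<lambda>q. (1 / \<alpha>1 (q$2)) *\<^sub>R axis 1 1)"
    by (simp_all add: boost_frame_def fun_eq_iff)
  (* the summand 0 is the derivative of the constant part ?B *)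
  have G: "((\<lambda>q. ?B + wedge (?w (q$2)) (hyp_vec (q$1))) has_derivative
      (\<lambda>v. 0 + (v$2 *\<^sub>R wedge (?w' (q$2)) (hyp_vec (q$1)) + v$1 *\<^sub>R wedge (?w (q$2)) (?u (q$1))))) (at q)"
    if "q \<in> D" for q
    by (intro has_derivative_add has_derivative_const has_derivative_separated_wedge
        w' has_vector_derivative_hyp_vec DI [OF that])
  have act_G: "act X (gauss_map \<phi> e) q
      = X q $ 2 *\<^sub>R wedge (?w' (q$2)) (hyp_vec (q$1)) + X q $ 1 *\<^sub>R wedge (?w (q$2)) (?u (q$1))"
    if "q \<in> D" for X q
  proof -
    have "act X (gauss_map \<phi> e) q = act X (\<lambda>q. ?B + wedge (?w (q$2)) (hyp_vec (q$1))) q"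
      by (rule act_cong_open [OF open_D that]) (simp add: gauss_map_eq deriv_radius DI)
    then show ?thesis by (simp only: act_eqI [OF G [OF that]] add_0)
  qed
  have inv_x: "((\<lambda>s. 1 / \<alpha>1 s) has_real_derivative - b1 / ?x\<^sup>2) (at (p$2))"
    using DI [OF p] radius_nonzero [of "p$2"] derivs(1) [of "p$2"] deriv_radius [of "p$2"]
    by (auto intro!: derivative_eq_intros simp: field_simps power2_eq_square)
  have 1: "act (e 1) (act (e 1) (gauss_map \<phi> e)) p = wedge (?w'' (p$2)) (hyp_vec (p$1))"
  proof -
    have "act (e 1) (act (e 1) (gauss_map \<phi> e)) p
        = act (e 1) (\<lambda>q. wedge (?w' (q$2)) (hyp_vec (q$1))) p"
      by (rule act_cong_open [OF open_D p]) (simp add: act_G e axis_def)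
    also have "\<dots> = wedge (?w'' (p$2)) (hyp_vec (p$1))"
      by (subst act_eqI [OF has_derivative_separated_wedge
            [OF w'' [OF DI [OF p] DI [OF p]] has_vector_derivative_hyp_vec(1)]])
         (simp add: e axis_def)
    finally show ?thesis .
  qed
  have 2: "act (e 2) (act (e 2) (gauss_map \<phi> e)) p
      = (1 / ?x\<^sup>2) *\<^sub>R wedge (?w (p$2)) (hyp_vec (p$1))"
  proof -
    have "act (e 2) (act (e 2) (gauss_map \<phi> e)) p
        = act (e 2) (\<lambda>q. wedge ((1 / \<alpha>1 (q$2)) *\<^sub>R ?w (q$2)) (?u (q$1))) p"
      by (rule act_cong_open [OF open_D p]) (simp add: act_G e axis_def scaleR_left)
    also have "\<dots> = (1 / ?x\<^sup>2) *\<^sub>R wedge (?w (p$2)) (hyp_vec (p$1))"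
      by (subst act_eqI [OF has_derivative_separated_wedge
            [OF has_vector_derivative_scaleR [OF inv_x w' [OF DI [OF p] DI [OF p]]]
              has_vector_derivative_hyp_vec(2)]])
         (simp add: e axis_def scaleR_left power2_eq_square)
    finally show ?thesis .
  qed
  have n1: "nabla g (e 1) (e 1) p = 0"
    unfolding nabla_eq [OF p] e
    by (subst act_eqI [OF has_derivative_const]) (simp add: axis_def vec_eq_iff forall_2)
  (* e 2 depends on s only, so its derivative along itself vanishes and only the
     Christoffel symbol contributes to n2 *)
  have "((\<lambda>s. (1 / \<alpha>1 s) *\<^sub>R (axis 1 1 :: real^2)) has_vector_derivative
      (1 / ?x) *\<^sub>R 0 + (- b1 / ?x\<^sup>2) *\<^sub>R axis 1 1) (at (p$2))"
    by (rule has_vector_derivative_scaleR [OF inv_x has_vector_derivative_const])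
  from act_eqI [OF has_derivative_component [OF this], of "e 2"]
  have "act (e 2) (e 2) p = 0"
    by (simp add: e axis_def)
  then have n2: "nabla g (e 2) (e 2) p = (- b1 / ?x) *\<^sub>R axis 2 1"
    unfolding nabla_eq [OF p] using radius_nonzero [OF DI [OF p]] deriv_radius [OF DI [OF p]]
    by (simp add: e axis_def vec_eq_iff forall_2 power2_eq_square)
  have "laplacian g e (gauss_map \<phi> e) p = - wedge
      (?w'' (p$2) + (b1 / ?x) *\<^sub>R ?w' (p$2) + (1 / ?x\<^sup>2) *\<^sub>R ?w (p$2)) (hyp_vec (p$1))"
    unfolding laplacian_def sum_2 1 2 act_G [OF p] n1 n2
    by (simp add: axis_def add_left scaleR_left)
  also have "?w'' (p$2) + (b1 / ?x) *\<^sub>R ?w' (p$2) + (1 / ?x\<^sup>2) *\<^sub>R ?w (p$2)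
      = plane_vec (radial_laplacian (deriv \<alpha>3) (p$2)) (radial_laplacian (deriv \<alpha>4) (p$2))"
    by (simp add: plane_vec_def vec_eq_iff forall_4 radial_laplacian_def)
  finally show ?thesis .
qed

section \<open>The pointwise 1-type condition\<close>

text \<open>In the components \<open>\<epsilon>\<^sub>k \<and> \<epsilon>\<^sub>1, \<epsilon>\<^sub>k \<and> \<epsilon>\<^sub>2\<close> (\<open>k = 3, 4\<close>) both \<open>\<Delta>G\<close> and \<open>G\<close> are multiples of
  \<open>(sinh t, cosh t)\<close>, hence so is the constant \<open>(C\<^sub>k\<^sub>1, C\<^sub>k\<^sub>2)\<close> wherever \<open>f\<close> is nonzero. By continuity
  of \<open>f\<close> this happens for two values of \<open>t\<close>, and \<open>(sinh t, cosh t)\<close> takes independent directions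
  there, so the constants are zero.\<close>

lemma pointwise_1_type_imp_parallel:
  assumes "pointwise_1_type_gauss_map D \<phi> e" and s: "s \<in> I"
  shows "radial_laplacian (deriv \<alpha>3) s * deriv \<alpha>4 s = radial_laplacian (deriv \<alpha>4) s * deriv \<alpha>3 s"
proof -
  let ?L3 = "radial_laplacian (deriv \<alpha>3)" and ?L4 = "radial_laplacian (deriv \<alpha>4)"
  obtain f C where f: "smooth_on D f" and eq:
    "\<And>p. p \<in> D \<Longrightarrow> laplacian g e (gauss_map \<phi> e) p = f p *\<^sub>R (gauss_map \<phi> e p + C)"
    using assms(1) unfolding pointwise_1_type_gauss_map_def by blast
  have E: "- ?L3 (p$2) * sinh (p$1) = f p * (deriv \<alpha>3 (p$2) * sinh (p$1) + C$3$1)"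
    "- ?L3 (p$2) * cosh (p$1) = f p * (deriv \<alpha>3 (p$2) * cosh (p$1) + C$3$2)"
    "- ?L4 (p$2) * sinh (p$1) = f p * (deriv \<alpha>4 (p$2) * sinh (p$1) + C$4$1)"
    "- ?L4 (p$2) * cosh (p$1) = f p * (deriv \<alpha>4 (p$2) * cosh (p$1) + C$4$2)" if "p \<in> D" for p
    using eq [OF that] unfolding laplacian_gauss_map [OF that] gauss_map_eq [OF that] vec_eq_iff forall_4
    by (simp_all add: wedge_def plane_vec_def hyp_vec_def axis_def)
  let ?p = "vector [0, s] :: real^2"
  have p: "?p \<in> D" using s by (simp add: boost_domain_def)
  show ?thesis
  proof (cases "\<forall>q\<in>D. f q = 0")
    case True
    then show ?thesis using E(2,4) [OF p] p by simp
  next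
    case False
    then obtain q where q: "q \<in> D" "f q \<noteq> 0" by blast
    have "isCont f q"
      using smooth_on_imp_differentiable [OF f q(1)] by (rule differentiable_imp_continuous_within)
    moreover have "isCont (\<lambda>h. q + h *\<^sub>R axis 1 1) (0::real)" by (intro continuous_intros)
    ultimately have "isCont (\<lambda>h. f (q + h *\<^sub>R axis 1 1)) 0"
      using isCont_o2 [of 0 "\<lambda>h. q + h *\<^sub>R axis 1 1" f] by simp
    then have "\<forall>\<^sub>F h in at 0. f (q + h *\<^sub>R axis 1 1) \<noteq> 0"
      using q(2) by (intro tendsto_imp_eventually_ne [of _ "f q"]) (auto simp: isCont_def)
    moreover have "\<forall>\<^sub>F h in at 0. h \<noteq> (0::real)"
      by (simp add: eventually_at_filter)
    ultimately have "\<forall>\<^sub>F h in at 0. f (q + h *\<^sub>R axis 1 1) \<noteq> 0 \<and> h \<noteq> 0"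
      by (rule eventually_conj)
    then obtain h where h: "f (q + h *\<^sub>R axis 1 1) \<noteq> 0" "h \<noteq> 0"
      using eventually_happens by fastforce
    have qh: "q + h *\<^sub>R axis 1 1 \<in> D"
      using q(1) by (simp add: boost_domain_def axis_def)
    (* the determinant of the two conditions on (a, b) is sinh h up to sign *)
    have zero: "a = 0 \<and> b = 0"
      if "a * cosh t = b * sinh t" "a * cosh (t + h) = b * sinh (t + h)" for a b t
    proof -
      have "sinh h \<noteq> 0" using h(2) by simp
      moreover have "sinh h = sinh (t + h) * cosh t - cosh (t + h) * sinh t"
        using sinh_diff [of "t + h" t] by simp
      ultimately have "sinh (t + h) * cosh t - cosh (t + h) * sinh t \<noteq> 0" by simp
      moreover have "a * (sinh (t + h) * cosh t - cosh (t + h) * sinh t) = 0"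
        "b * (sinh (t + h) * cosh t - cosh (t + h) * sinh t) = 0"
        using that by algebra+
      ultimately show ?thesis by simp
    qed
    (* eliminate the left-hand sides of E between the components 1 and 2 *)
    have C: "C$3$1 * cosh (r$1) = C$3$2 * sinh (r$1)" "C$4$1 * cosh (r$1) = C$4$2 * sinh (r$1)"
      if "r \<in> D" "f r \<noteq> 0" for r
    proof -
      have "f r * (C$3$1 * cosh (r$1) - C$3$2 * sinh (r$1)) = 0"
        "f r * (C$4$1 * cosh (r$1) - C$4$2 * sinh (r$1)) = 0"
        using E [OF that(1)] by algebra+
      with that(2) show "C$3$1 * cosh (r$1) = C$3$2 * sinh (r$1)"
        "C$4$1 * cosh (r$1) = C$4$2 * sinh (r$1)" by simp_all
    qed
    have "C$3$2 = 0" "C$4$2 = 0"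
      using zero [of "C$3$1" "q$1" "C$3$2"] zero [of "C$4$1" "q$1" "C$4$2"] C [OF q] C [OF qh h(1)]
      by (simp_all add: axis_def)
    then show ?thesis using E(2,4) [OF p] by simp algebra
  qed
qed

text \<open>The quantity \<open>q = \<alpha>1 det(w, w')\<close> has derivative \<open>\<alpha>1 det(w, L w) = 0\<close>. Since \<open>w\<close> has constant
  length, \<open>w'\<close> is orthogonal to \<open>w\<close> and thus determined by \<open>q\<close>; dividing by \<open>\<bar>w\<bar>\<^sup>2 = 1 + b1\<^sup>2\<close> gives
  the constant of the turning rate.\<close>

lemma parallel_imp_turning:
  assumes "\<And>s. s \<in> I \<Longrightarrow>
    radial_laplacian (deriv \<alpha>3) s * deriv \<alpha>4 s = radial_laplacian (deriv \<alpha>4) s * deriv \<alpha>3 s"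
  shows "\<exists>c. turning c"
proof -
  let ?q = "\<lambda>s. \<alpha>1 s * (deriv \<alpha>3 s * deriv (deriv \<alpha>4) s - deriv \<alpha>4 s * deriv (deriv \<alpha>3) s)"
  have const: "(?q has_real_derivative 0) (at s)" if s: "s \<in> I" for s
  proof -
    let ?q' = "b1 * (deriv \<alpha>3 s * deriv (deriv \<alpha>4) s - deriv \<alpha>4 s * deriv (deriv \<alpha>3) s)
      + \<alpha>1 s * (deriv \<alpha>3 s * deriv (deriv (deriv \<alpha>4)) s - deriv \<alpha>4 s * deriv (deriv (deriv \<alpha>3)) s)"
    have "(?q has_real_derivative ?q') (at s)"
      using derivs(1,5-8) [OF s] deriv_radius [OF s]
      by (auto intro!: derivative_eq_intros simp: algebra_simps)
    moreover have "?q' = \<alpha>1 s * (deriv \<alpha>3 s * radial_laplacian (deriv \<alpha>4) s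
        - deriv \<alpha>4 s * radial_laplacian (deriv \<alpha>3) s)"
      using radius_nonzero [OF s] by (simp add: radial_laplacian_def field_simps)
    ultimately show ?thesis using assms [OF s] by (simp add: mult.commute)
  qed
  obtain k where k: "\<And>s. s \<in> I \<Longrightarrow> ?q s = k"
    using DERIV_zero_imp_constant [OF interval_I const] by blast
  have "turning (k / (1 + b1\<^sup>2))"
    unfolding turning_def
  proof (intro ballI)
    fix s assume s: "s \<in> I"
    let ?n = "\<lambda>s. (deriv \<alpha>3 s)\<^sup>2 + (deriv \<alpha>4 s)\<^sup>2"
    have "(?n has_real_derivative
        2 * (deriv \<alpha>3 s * deriv (deriv \<alpha>3) s + deriv \<alpha>4 s * deriv (deriv \<alpha>4) s)) (at s)"
      using derivs(5,6) [OF s] by (auto intro!: derivative_eq_intros)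
    moreover have "(?n has_real_derivative 0) (at s)"
      by (rule has_field_derivative_transform_within_open [OF DERIV_const open_I s])
         (simp add: velocity_norm)
    ultimately have orth: "deriv \<alpha>3 s * deriv (deriv \<alpha>3) s + deriv \<alpha>4 s * deriv (deriv \<alpha>4) s = 0"
      using DERIV_unique by fastforce
    have nz: "1 + b1\<^sup>2 \<noteq> 0" "\<alpha>1 s \<noteq> 0"
      using radius_nonzero [OF s] by (simp_all add: add_nonneg_eq_0_iff)
    have "\<alpha>1 s * (1 + b1\<^sup>2) * deriv (deriv \<alpha>3) s = - k * deriv \<alpha>4 s"
      "\<alpha>1 s * (1 + b1\<^sup>2) * deriv (deriv \<alpha>4) s = k * deriv \<alpha>3 s"
      using orth velocity_norm [OF s] k [OF s] by algebra+
    moreover have "\<alpha>1 s * (1 + b1\<^sup>2) \<noteq> 0" using nz by simp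
    ultimately have "deriv (deriv \<alpha>3) s = - k * deriv \<alpha>4 s / (\<alpha>1 s * (1 + b1\<^sup>2))"
      "deriv (deriv \<alpha>4) s = k * deriv \<alpha>3 s / (\<alpha>1 s * (1 + b1\<^sup>2))"
      by (metis nonzero_mult_div_cancel_left)+
    then show "deriv (deriv \<alpha>3) s = - (k / (1 + b1\<^sup>2) / \<alpha>1 s) * deriv \<alpha>4 s \<and>
        deriv (deriv \<alpha>4) s = k / (1 + b1\<^sup>2) / \<alpha>1 s * deriv \<alpha>3 s"
      by (simp add: mult.commute)
  qed
  then show ?thesis ..
qed

text \<open>Differentiating \<open>w' = (c/\<alpha>1) J w\<close>, with \<open>J\<close> the rotation by a right angle, gives
  \<open>w'' = - (b1/\<alpha>1) w' - (c/\<alpha>1)\<^sup>2 w\<close>. The first term cancels against the first-order term of \<open>L w\<close>, so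
  \<open>w\<close> is an eigenvector of \<open>L\<close> at every point. The vector \<open>C\<close> removes the constant part of \<open>G\<close>.\<close>

lemma turning_imp_pointwise_1_type:
  assumes "turning c"
  shows "pointwise_1_type_gauss_map D \<phi> e"
  unfolding pointwise_1_type_gauss_map_def
proof (intro exI conjI ballI)
  have "b1 * p$2 + b2 \<noteq> 0" if "p \<in> D" for p
    using that radius_affine radius_nonzero by (metis boost_domain_def mem_Collect_eq)
  then show "smooth_on D (\<lambda>p. (c\<^sup>2 - 1) / (b1 * p$2 + b2) ^ 2)"
    by (rule smooth_on_inverse_power_affine [OF open_D])
  show "- b1 *\<^sub>R wedge (axis 1 1) (axis 2 1) \<in> bivectors"
    by (simp add: bivectors_def transpose_def wedge_def vec_eq_iff right_diff_distrib)
  fix p assume p: "p \<in> D"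
  then have s: "p$2 \<in> I" by (simp add: boost_domain_def)
  let ?s = "p$2"
  have t: "deriv (deriv \<alpha>3) s = - (c / \<alpha>1 s) * deriv \<alpha>4 s"
    "deriv (deriv \<alpha>4) s = c / \<alpha>1 s * deriv \<alpha>3 s" if "s \<in> I" for s
    using assms that unfolding turning_def by auto
  have "((\<lambda>s. - (c / \<alpha>1 s) * deriv \<alpha>4 s) has_real_derivative
      c * b1 / (\<alpha>1 ?s)\<^sup>2 * deriv \<alpha>4 ?s - (c / \<alpha>1 ?s)\<^sup>2 * deriv \<alpha>3 ?s) (at ?s)"
    "((\<lambda>s. c / \<alpha>1 s * deriv \<alpha>3 s) has_real_derivative
      - (c * b1 / (\<alpha>1 ?s)\<^sup>2) * deriv \<alpha>3 ?s - (c / \<alpha>1 ?s)\<^sup>2 * deriv \<alpha>4 ?s) (at ?s)"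
    using derivs(1,5,6) [OF s] deriv_radius [OF s] t [OF s] radius_nonzero [OF s]
    by (auto intro!: derivative_eq_intros simp: field_simps power2_eq_square)
  then have "(deriv (deriv \<alpha>3) has_real_derivative
      c * b1 / (\<alpha>1 ?s)\<^sup>2 * deriv \<alpha>4 ?s - (c / \<alpha>1 ?s)\<^sup>2 * deriv \<alpha>3 ?s) (at ?s)"
    "(deriv (deriv \<alpha>4) has_real_derivative
      - (c * b1 / (\<alpha>1 ?s)\<^sup>2) * deriv \<alpha>3 ?s - (c / \<alpha>1 ?s)\<^sup>2 * deriv \<alpha>4 ?s) (at ?s)"
    by (auto elim!: has_field_derivative_transform_within_open [OF _ open_I s] simp: t)
  then have "deriv (deriv (deriv \<alpha>3)) ?s
      = c * b1 / (\<alpha>1 ?s)\<^sup>2 * deriv \<alpha>4 ?s - (c / \<alpha>1 ?s)\<^sup>2 * deriv \<alpha>3 ?s"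
    "deriv (deriv (deriv \<alpha>4)) ?s
      = - (c * b1 / (\<alpha>1 ?s)\<^sup>2) * deriv \<alpha>3 ?s - (c / \<alpha>1 ?s)\<^sup>2 * deriv \<alpha>4 ?s"
    by (auto intro: DERIV_imp_deriv)
  then have L: "radial_laplacian (deriv \<alpha>3) ?s = (1 - c\<^sup>2) / (\<alpha>1 ?s)\<^sup>2 * deriv \<alpha>3 ?s"
    "radial_laplacian (deriv \<alpha>4) ?s = (1 - c\<^sup>2) / (\<alpha>1 ?s)\<^sup>2 * deriv \<alpha>4 ?s"
    unfolding radial_laplacian_def t [OF s]
    using radius_nonzero [OF s] by (simp_all add: field_simps power2_eq_square)
  show "laplacian g e (gauss_map \<phi> e) p = ((c\<^sup>2 - 1) / (b1 * p$2 + b2) ^ 2) *\<^sub>R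
      (gauss_map \<phi> e p + - b1 *\<^sub>R wedge (axis 1 1) (axis 2 1))"
  proof -
    have scale: "- wedge (plane_vec (k * a) (k * b)) v = (- k) *\<^sub>R wedge (plane_vec a b) v" for k a b v
      by (simp add: wedge_def plane_vec_def vec_eq_iff forall_4 algebra_simps)
    have coeff: "- ((1 - c\<^sup>2) / (\<alpha>1 (p$2))\<^sup>2) = (c\<^sup>2 - 1) / (b1 * p$2 + b2)\<^sup>2"
      unfolding radius_affine [OF s] by (simp add: diff_divide_distrib)
    show ?thesis
      unfolding laplacian_gauss_map [OF p] gauss_map_eq [OF p] deriv_radius [OF s] L scale coeff by simp
  qed
qed

section \<open>Integration of the profile curves\<close>

text \<open>Rotating \<open>w\<close> back by the angle \<open>\<Theta>\<close> yields a constant vector \<open>(A, B)\<close>, whose polar angle is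
  the phase \<open>\<theta>\<close>. This avoids lifting \<open>w\<close> to an angle function.\<close>

lemma turning_imp_angle:
  assumes "turning c" and \<Theta>: "\<And>s. s \<in> I \<Longrightarrow> (\<Theta> has_real_derivative c / \<alpha>1 s) (at s)"
  obtains \<theta> where "\<And>s. s \<in> I \<Longrightarrow> deriv \<alpha>3 s = sqrt (1 + b1\<^sup>2) * cos (\<Theta> s + \<theta>)"
    "\<And>s. s \<in> I \<Longrightarrow> deriv \<alpha>4 s = sqrt (1 + b1\<^sup>2) * sin (\<Theta> s + \<theta>)"
proof -
  let ?r = "sqrt (1 + b1\<^sup>2)"
  let ?A = "\<lambda>s. cos (\<Theta> s) * deriv \<alpha>3 s + sin (\<Theta> s) * deriv \<alpha>4 s"
  let ?B = "\<lambda>s. cos (\<Theta> s) * deriv \<alpha>4 s - sin (\<Theta> s) * deriv \<alpha>3 s"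
  have const: "(?A has_real_derivative 0) (at s)" "(?B has_real_derivative 0) (at s)" if s: "s \<in> I" for s
    using \<Theta> [OF s] derivs(5,6) [OF s] assms(1) s unfolding turning_def
    by (auto intro!: derivative_eq_intros)
  obtain A B where AB: "\<And>s. s \<in> I \<Longrightarrow> ?A s = A" "\<And>s. s \<in> I \<Longrightarrow> ?B s = B"
    using DERIV_zero_imp_constant [OF interval_I const(1)]
      DERIV_zero_imp_constant [OF interval_I const(2)] by blast
  have w: "deriv \<alpha>3 s = cos (\<Theta> s) * A - sin (\<Theta> s) * B"
    "deriv \<alpha>4 s = sin (\<Theta> s) * A + cos (\<Theta> s) * B" if "s \<in> I" for s
    unfolding AB [OF that, symmetric] using sin_cos_squared_add2 [of "\<Theta> s"] by algebra+
  obtain s0 where s0: "s0 \<in> I" using nonempty_I by blast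
  have "A\<^sup>2 + B\<^sup>2 = 1 + b1\<^sup>2"
    unfolding AB [OF s0, symmetric] velocity_norm [OF s0, symmetric]
    using sin_cos_squared_add2 [of "\<Theta> s0"] by algebra
  moreover have pos: "1 + b1\<^sup>2 > 0" by (simp add: add_pos_nonneg)
  ultimately have "(A / ?r)\<^sup>2 + (B / ?r)\<^sup>2 = 1"
    by (simp add: power_divide flip: add_divide_distrib)
  then obtain \<theta> where "A / ?r = cos \<theta>" "B / ?r = sin \<theta>"
    using sincos_total_2pi by metis
  then have "A = ?r * cos \<theta>" "B = ?r * sin \<theta>" using pos by (auto simp: field_simps)
  then show ?thesis
    using w by (intro that [of \<theta>]) (simp_all add: cos_add sin_add algebra_simps)
qed

text \<open>The phase is removed by the rotation by \<open>-\<theta>\<close>. The logarithm has the factor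
  \<open>b = c/b1\<close>, which corresponds to \<open>b3 = c \<surd>(1 + b1\<^sup>2)\<close>.\<close>

lemma turning_imp_profile_log:
  assumes "turning c" "b1 \<noteq> 0"
  shows "up_to_motion (profile_log I) \<alpha>1 \<alpha>3 \<alpha>4"
proof -
  let ?r = "sqrt (1 + b1\<^sup>2)"
  let ?\<Theta> = "\<lambda>s. c / b1 * ln \<bar>b1 * s + b2\<bar>"
  have "(?\<Theta> has_real_derivative c / \<alpha>1 s) (at s)" if s: "s \<in> I" for s
    using DERIV_log_affine [of b1 s b2 "c / b1"] radius_nonzero [OF s] radius_affine [OF s] assms(2)
    by simp
  from turning_imp_angle [OF assms(1) this] obtain \<theta> where
    w: "\<And>s. s \<in> I \<Longrightarrow> deriv \<alpha>3 s = ?r * cos (?\<Theta> s + \<theta>)"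
      "\<And>s. s \<in> I \<Longrightarrow> deriv \<alpha>4 s = ?r * sin (?\<Theta> s + \<theta>)" by blast
  have rot: "cos (- \<theta>) * (?r * cos (x + \<theta>)) - sin (- \<theta>) * (?r * sin (x + \<theta>)) = ?r * cos x"
    "sin (- \<theta>) * (?r * cos (x + \<theta>)) + cos (- \<theta>) * (?r * sin (x + \<theta>)) = ?r * sin x" for x
  proof -
    have "cos x = cos (x + \<theta>) * cos \<theta> + sin (x + \<theta>) * sin \<theta>"
      "sin x = sin (x + \<theta>) * cos \<theta> - cos (x + \<theta>) * sin \<theta>"
      using cos_diff [of "x + \<theta>" \<theta>] sin_diff [of "x + \<theta>" \<theta>] by simp_all
    then show "cos (- \<theta>) * (?r * cos (x + \<theta>)) - sin (- \<theta>) * (?r * sin (x + \<theta>)) = ?r * cos x"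
      "sin (- \<theta>) * (?r * cos (x + \<theta>)) + cos (- \<theta>) * (?r * sin (x + \<theta>)) = ?r * sin x"
      unfolding cos_minus sin_minus by algebra+
  qed
  have "((\<lambda>s. cos (- \<theta>) * \<alpha>3 s - sin (- \<theta>) * \<alpha>4 s + 0) has_real_derivative
        cos (- \<theta>) * deriv \<alpha>3 s - sin (- \<theta>) * deriv \<alpha>4 s) (at s)"
    "((\<lambda>s. sin (- \<theta>) * \<alpha>3 s + cos (- \<theta>) * \<alpha>4 s + 0) has_real_derivative
        sin (- \<theta>) * deriv \<alpha>3 s + cos (- \<theta>) * deriv \<alpha>4 s) (at s)" if s: "s \<in> I" for s
    using derivs(2,3) [OF s] by (auto intro!: derivative_eq_intros)
  then have "profile_log I \<alpha>1 (\<lambda>s. cos (- \<theta>) * \<alpha>3 s - sin (- \<theta>) * \<alpha>4 s + 0)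
      (\<lambda>s. sin (- \<theta>) * \<alpha>3 s + cos (- \<theta>) * \<alpha>4 s + 0)"
    unfolding profile_log_def using assms(2) radius_affine w rot
    by (intro exI [of _ b1] exI [of _ b2] exI [of _ "c * ?r"] exI [of _ "c / b1"])
       (simp add: add_nonneg_eq_0_iff)
  then show ?thesis unfolding up_to_motion_def by blast
qed

text \<open>For constant radius the velocity is \<open>(cos (k s + \<theta>), sin (k s + \<theta>))\<close>. Its antiderivative is a
  circle if \<open>k \<noteq> 0\<close>, which needs only a translation to take the required form with \<open>a\<^sub>2 = -k\<close> and
  \<open>a\<^sub>3 = -\<theta> - \<pi>/2\<close>. If \<open>k = 0\<close> it is a line of direction \<open>\<theta>\<close>, which must be rotated onto the
  \<open>x\<^sub>3\<close>-axis.\<close>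

lemma turning_imp_profile_circle_or_line:
  assumes "turning c" and b1: "b1 = 0"
  shows "up_to_motion (profile_circle I) \<alpha>1 \<alpha>3 \<alpha>4 \<or> up_to_motion (profile_line I) \<alpha>1 \<alpha>3 \<alpha>4"
proof -
  have \<alpha>1: "\<alpha>1 s = b2" if "s \<in> I" for s using radius_affine [OF that] b1 by simp
  define k where "k = c / b2"
  have "((\<lambda>s. k * s) has_real_derivative c / \<alpha>1 s) (at s)" if "s \<in> I" for s
    unfolding k_def \<alpha>1 [OF that] by (rule DERIV_cmult_Id)
  from turning_imp_angle [OF assms(1) this] obtain \<theta> where
    "\<And>s. s \<in> I \<Longrightarrow> deriv \<alpha>3 s = sqrt (1 + b1\<^sup>2) * cos (k * s + \<theta>)"
    "\<And>s. s \<in> I \<Longrightarrow> deriv \<alpha>4 s = sqrt (1 + b1\<^sup>2) * sin (k * s + \<theta>)" by blast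
  then have w: "\<And>s. s \<in> I \<Longrightarrow> deriv \<alpha>3 s = cos (k * s + \<theta>)" "\<And>s. s \<in> I \<Longrightarrow> deriv \<alpha>4 s = sin (k * s + \<theta>)"
    using b1 by simp_all
  show ?thesis
  proof (cases "k = 0")
    case True
    have "((\<lambda>s. s - (cos (- \<theta>) * \<alpha>3 s - sin (- \<theta>) * \<alpha>4 s)) has_real_derivative
        1 - (cos (- \<theta>) * deriv \<alpha>3 s - sin (- \<theta>) * deriv \<alpha>4 s)) (at s)"
      "((\<lambda>s. - (sin (- \<theta>) * \<alpha>3 s + cos (- \<theta>) * \<alpha>4 s)) has_real_derivative
        - (sin (- \<theta>) * deriv \<alpha>3 s + cos (- \<theta>) * deriv \<alpha>4 s)) (at s)" if s: "s \<in> I" for s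
      using derivs(2,3) [OF s] by (auto intro!: derivative_eq_intros)
    moreover have "1 - (cos (- \<theta>) * deriv \<alpha>3 s - sin (- \<theta>) * deriv \<alpha>4 s) = 0"
      "- (sin (- \<theta>) * deriv \<alpha>3 s + cos (- \<theta>) * deriv \<alpha>4 s) = 0" if s: "s \<in> I" for s
      using w [OF s] True sin_cos_squared_add3 [of \<theta>] by simp_all
    ultimately have const:
      "((\<lambda>s. s - (cos (- \<theta>) * \<alpha>3 s - sin (- \<theta>) * \<alpha>4 s)) has_real_derivative 0) (at s)"
      "((\<lambda>s. - (sin (- \<theta>) * \<alpha>3 s + cos (- \<theta>) * \<alpha>4 s)) has_real_derivative 0) (at s)"
      if "s \<in> I" for s using that by (simp_all only:)
    obtain c3 where c3: "\<And>s. s \<in> I \<Longrightarrow> s - (cos (- \<theta>) * \<alpha>3 s - sin (- \<theta>) * \<alpha>4 s) = c3"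
      using DERIV_zero_imp_constant [OF interval_I const(1)] by blast
    obtain c4 where c4: "\<And>s. s \<in> I \<Longrightarrow> - (sin (- \<theta>) * \<alpha>3 s + cos (- \<theta>) * \<alpha>4 s) = c4"
      using DERIV_zero_imp_constant [OF interval_I const(2)] by blast
    have "profile_line I \<alpha>1 (\<lambda>s. cos (- \<theta>) * \<alpha>3 s - sin (- \<theta>) * \<alpha>4 s + c3)
      (\<lambda>s. sin (- \<theta>) * \<alpha>3 s + cos (- \<theta>) * \<alpha>4 s + c4)"
      unfolding profile_line_def
    proof (intro exI [of _ b2] ballI conjI)
      fix s assume s: "s \<in> I"
      show "\<alpha>1 s = b2" by (rule \<alpha>1 [OF s])
      show "cos (- \<theta>) * \<alpha>3 s - sin (- \<theta>) * \<alpha>4 s + c3 = s" using c3 [OF s] by linarith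
      show "sin (- \<theta>) * \<alpha>3 s + cos (- \<theta>) * \<alpha>4 s + c4 = 0" using c4 [OF s] by linarith
    qed
    then show ?thesis unfolding up_to_motion_def by blast
  next
    case False
    have const: "((\<lambda>s. sin (k * s + \<theta>) / k - \<alpha>3 s) has_real_derivative 0) (at s)"
      "((\<lambda>s. - cos (k * s + \<theta>) / k - \<alpha>4 s) has_real_derivative 0) (at s)" if s: "s \<in> I" for s
      using derivs(2,3) [OF s] w [OF s] False by (auto intro!: derivative_eq_intros)
    obtain c3 where c3: "\<And>s. s \<in> I \<Longrightarrow> sin (k * s + \<theta>) / k - \<alpha>3 s = c3"
      using DERIV_zero_imp_constant [OF interval_I const(1)] by blast
    obtain c4 where c4: "\<And>s. s \<in> I \<Longrightarrow> - cos (k * s + \<theta>) / k - \<alpha>4 s = c4"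
      using DERIV_zero_imp_constant [OF interval_I const(2)] by blast
    have "profile_circle I \<alpha>1 (\<lambda>s. cos 0 * \<alpha>3 s - sin 0 * \<alpha>4 s + c3)
      (\<lambda>s. sin 0 * \<alpha>3 s + cos 0 * \<alpha>4 s + c4)"
      unfolding profile_circle_def
    proof (rule exI [of _ b2], rule exI [of _ "- k"], rule exI [of _ "- \<theta> - pi / 2"], intro ballI conjI)
      show "- k \<noteq> 0" using False by simp
      fix s assume s: "s \<in> I"
      show "\<alpha>1 s = b2" by (rule \<alpha>1 [OF s])
      have shift: "- k * s + (- \<theta> - pi / 2) = - (k * s + \<theta>) - pi / 2" by simp
      have angle: "cos (- k * s + (- \<theta> - pi / 2)) = - sin (k * s + \<theta>)"
        "sin (- k * s + (- \<theta> - pi / 2)) = - cos (k * s + \<theta>)"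
        unfolding shift cos_diff sin_diff cos_minus sin_minus by simp_all
      show "cos 0 * \<alpha>3 s - sin 0 * \<alpha>4 s + c3 = 1 / - k * cos (- k * s + (- \<theta> - pi / 2))"
        unfolding angle using c3 [OF s] by simp
      show "sin 0 * \<alpha>3 s + cos 0 * \<alpha>4 s + c4 = - (1 / - k) * sin (- k * s + (- \<theta> - pi / 2))"
        unfolding angle using c4 [OF s] by simp
    qed
    then show ?thesis unfolding up_to_motion_def by blast
  qed
qed

end

theorem theorem1:
  fixes I :: "real set" and \<alpha>1 \<alpha>3 \<alpha>4 :: "real \<Rightarrow> real"
  assumes "open I" and "is_interval I" and "I \<noteq> {}"
    and "smooth_on I \<alpha>1" and "smooth_on I \<alpha>3" and "smooth_on I \<alpha>4"
    and "\<forall>s\<in>I. - (deriv \<alpha>1 s)\<^sup>2 + (deriv \<alpha>3 s)\<^sup>2 + (deriv \<alpha>4 s)\<^sup>2 = 1"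
    and "spacelike_immersion (boost_domain I) (boost_surface \<alpha>1 \<alpha>3 \<alpha>4)"
    and "flat_surface (boost_domain I) (boost_surface \<alpha>1 \<alpha>3 \<alpha>4)"
  shows "pointwise_1_type_gauss_map (boost_domain I) (boost_surface \<alpha>1 \<alpha>3 \<alpha>4) (boost_frame \<alpha>1)
    \<longleftrightarrow> up_to_motion (profile_circle I) \<alpha>1 \<alpha>3 \<alpha>4
      \<or> up_to_motion (profile_log I) \<alpha>1 \<alpha>3 \<alpha>4
      \<or> up_to_motion (profile_line I) \<alpha>1 \<alpha>3 \<alpha>4"
proof -
  have "\<alpha>1 s \<noteq> 0" if "s \<in> I" for s
    using assms(4-6) [THEN smooth_on_imp_differentiable, OF that]
    by (rule spacelike_immersion_radius_nonzero [OF assms(8) that])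
  then interpret boost_profile I \<alpha>1 \<alpha>3 \<alpha>4
    using assms(1-7) by unfold_locales auto
  obtain b1 b2 where "\<And>s. s \<in> I \<Longrightarrow> \<alpha>1 s = b1 * s + b2"
    using flat_imp_affine [OF assms(9)] by blast
  then interpret flat_boost_profile I \<alpha>1 \<alpha>3 \<alpha>4 b1 b2
    by unfold_locales
  have "pointwise_1_type_gauss_map D \<phi> e \<longleftrightarrow> (\<exists>c. turning c)"
    using pointwise_1_type_imp_parallel parallel_imp_turning turning_imp_pointwise_1_type by blast
  also have "\<dots> \<longleftrightarrow> up_to_motion (profile_circle I) \<alpha>1 \<alpha>3 \<alpha>4
      \<or> up_to_motion (profile_log I) \<alpha>1 \<alpha>3 \<alpha>4 \<or> up_to_motion (profile_line I) \<alpha>1 \<alpha>3 \<alpha>4"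
    using turning_if_profile_circle turning_if_profile_log turning_if_profile_line
      turning_imp_profile_log turning_imp_profile_circle_or_line by blast
  finally show ?thesis .
qed

end
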